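(* Let $f:\mathbb{R}^D\to\mathbb{R}$ be continuous, attain its global minimum $f^*$, and have effective dimensionality $d_e\le d$ with effective subspace $\mathcal{T}$ spanned by the columns of $\boldsymbol{U}\in\mathbb{R}^{D\times d_e}$. Let $\boldsymbol{x}^*\in\mathcal{G}$ be a global minimizer whose projection $\boldsymbol{x}_\top^*=\boldsymbol{U}\boldsymbol{U}^T\boldsymbol{x}^*$ is non-zero, let $\mathcal{G}^*=\boldsymbol{x}_\top^*+\mathcal{T}^\perp$, let $\boldsymbol{A}$ be a $D\times d$ Gaussian matrix, and let $\boldsymbol{y}_2^*$ be the minimal Euclidean norm element of $S^*=\{\boldsymbol{y}\in\mathbb{R}^d:\boldsymbol{A}\boldsymbol{y}\in\mathcal{G}^*\}$. Then the probability density function of $\boldsymbol{y}_2^*$ (with respect to Lebesgue measure on $\mathbb{R}^d$) is given, for $\boldsymbol{y}\ne\boldsymbol{0}$, by $$g^*(\boldsymbol{y})=\pi^{-d/2}\left(\frac{\Gamma(d/2)}{\Gamma(n/2)}\right)\left(\frac{\|\boldsymbol{x}_\top^*\|}{\sqrt{2}}\right)^n(\boldsymbol{y}^T\boldsymbol{y})^{-(n+d)/2}e^{-\|\boldsymbol{x}_\top^*\|^2/(2\boldsymbol{y}^T\boldsymbol{y})},$$ where $n=d-d_e+1$.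
   Context: Effective dimensionality: $f:\mathbb{R}^D\to\mathbb{R}$ has effective dimensionality $d_e\le D$ if there is a linear subspace $\mathcal{T}\subseteq\mathbb{R}^D$ of dimension $d_e$ such that $f(\boldsymbol{x}_\top+\boldsymbol{x}_\perp)=f(\boldsymbol{x}_\top)$ for all $\boldsymbol{x}_\top\in\mathcal{T}$ and $\boldsymbol{x}_\perp\in\mathcal{T}^\perp$, and $d_e$ is the smallest integer with this property. $\mathcal{T}$ is called the effective subspace and $\mathcal{T}^\perp$ the constant subspace. The matrices $\boldsymbol{U}\in\mathbb{R}^{D\times d_e}$ and $\boldsymbol{V}\in\mathbb{R}^{D\times(D-d_e)}$ have orthonormal columns spanning $\mathcal{T}$ and $\mathcal{T}^\perp$ respectively. $\mathcal{G}=\{\boldsymbol{x}\in\mathbb{R}^D: f(\boldsymbol{x})=f^*\}$ is the set of global minimizers, where $f^*=\min_{\boldsymbol{x}\in\mathbb{R}^D} f(\boldsymbol{x})$. A Gaussian matrix is a random matrix whose entries are independent standard normal random variables. $\|\cdot\|$ is the Euclidean norm and $\Gamma$ the gamma function. The random vector $\boldsymbol{y}_2^*=\arg\min\{\|\boldsymbol{y}\|_2:\boldsymbol{y}\in S^*\}$ is understood to be defined on the probability-one event that $S^*$ is nonempty. *)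

theory Defs
  imports "HOL-Probability.Probability"
begin

definition constant_along_complement :: "(real ^ 'D \<Rightarrow> real) \<Rightarrow> (real ^ 'D) set \<Rightarrow> bool" where
  "constant_along_complement f T \<longleftrightarrow>
     subspace T \<and> (\<forall>x\<in>T. \<forall>y\<in>T\<^sup>\<bottom>. f (x + y) = f x)"

definition effective_dim :: "(real ^ 'D \<Rightarrow> real) \<Rightarrow> nat" where
  "effective_dim f = (LEAST k. \<exists>T. constant_along_complement f T \<and> dim T = k)"

definition effective_subspace :: "(real ^ 'D \<Rightarrow> real) \<Rightarrow> (real ^ 'D) set \<Rightarrow> bool" where
  "effective_subspace f T \<longleftrightarrow> constant_along_complement f T \<and> dim T = effective_dim f"

definition is_global_min_value :: "('a \<Rightarrow> real) \<Rightarrow> real \<Rightarrow> bool" where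
  "is_global_min_value f m \<longleftrightarrow> m \<in> range f \<and> (\<forall>x. m \<le> f x)"

text \<open>\<^const>\<open>columns\<close> forgets repetitions, so orthonormality is stated by column index.\<close>

definition orthonormal_columns :: "real ^ 'e ^ 'D \<Rightarrow> bool" where
  "orthonormal_columns U \<longleftrightarrow>
     (\<forall>i j. column i U \<bullet> column j U = (if i = j then 1 else 0))"

definition gaussian_matrix :: "'a measure \<Rightarrow> ('a \<Rightarrow> real ^ 'd ^ 'D) \<Rightarrow> bool" where
  "gaussian_matrix M A \<longleftrightarrow>
     prob_space.indep_vars M (\<lambda>_. borel) (\<lambda>(i, j) \<omega>. A \<omega> $ i $ j) UNIV \<and>
     (\<forall>i j. distributed M lborel (\<lambda>\<omega>. A \<omega> $ i $ j) std_normal_density)"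

definition solution_set :: "real ^ 'd ^ 'D \<Rightarrow> (real ^ 'D) set \<Rightarrow> (real ^ 'd) set" where
  "solution_set A G = {y. A *v y \<in> G}"

text \<open>
  For a non-empty closed affine set the minimiser of the norm exists and is unique. On the empty
  set \<^const>\<open>arg_min_on\<close> is an arbitrary constant, so for a random set that is almost surely
  non-empty this only fixes the value on a null event.
\<close>

definition min_norm_element :: "(real ^ 'd) set \<Rightarrow> real ^ 'd" where
  "min_norm_element S = arg_min_on norm S"

text \<open>
  The formula describes the density off the origin. At \<open>y = 0\<close> it evaluates to \<open>0\<close> by the
  convention \<open>0 powr a = 0\<close>, which is immaterial because \<open>{0}\<close> is a Lebesgue null set.
\<close>

definition min_norm_density :: "nat \<Rightarrow> real ^ 'D \<Rightarrow> real ^ 'd \<Rightarrow> real" where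
  "min_norm_density n xt y =
     pi powr (- real CARD('d) / 2) * (Gamma (real CARD('d) / 2) / Gamma (real n / 2)) *
     (norm xt / sqrt 2) ^ n * (y \<bullet> y) powr (- (real n + real CARD('d)) / 2) *
     exp (- (norm xt)\<^sup>2 / (2 * (y \<bullet> y)))"

end

theory Submission
  imports Defs
begin

text \<open>
  Choose an orthonormal basis \<open>u, b\<^sub>2, \<dots>\<close> of \<open>T\<close> with \<open>u = xtop / norm xtop\<close>. Then \<open>A y \<in> Gstar\<close> says that
  \<open>y\<close> has inner product \<open>r = norm xtop\<close> with \<open>A\<^sup>T u\<close> and \<open>0\<close> with every \<open>A\<^sup>T b\<^sub>k\<close>, and the solution of minimal norm is
  \<open>r w / (w \<bullet> w)\<close>, where \<open>w\<close> is the component of \<open>A\<^sup>T u\<close> orthogonal to all \<open>A\<^sup>T b\<^sub>k\<close>. The vectors \<open>A\<^sup>T u\<close>, \<open>A\<^sup>T b\<^sub>k\<close> are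
  independent standard Gaussian, so \<open>norm w\<close> is chi distributed with \<open>n\<close> degrees of freedom. This
  gives the law of the norm \<open>r / norm w\<close>. Moreover the law of the solution is invariant under
  orthogonal maps of the domain, and so is the claimed density; a finite rotation-invariant
  measure is determined by the law of the norm.
\<close>

section \<open>Rotation-invariant measures on Euclidean space\<close>

text \<open>Independence is handled geometrically. The law of the whole matrix is one measure,
  \<open>std_gauss\<close>, on matrix space, and every orthogonal map of that space preserves it.
  Multiplying by an orthogonal matrix on the left turns A^T u and the A^T b_k into actual rows of
  the matrix; multiplying on the right rotates all rows at once and with them the solution. An
  orthogonal map of matrix space times row space exchanges one row with a fresh Gaussian vector, so
  that this row can be integrated while the others stay fixed. Comparing measures by the law of the
  norm spares any disintegration over spheres: the random direction that this needs is itself taken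
  from a Gaussian vector. The formula then arises as the chi density with n degrees of freedom,
  transported by t -> r / t and divided by the area of the sphere of radius s in dimension d. Here n
  = d - (d_e - 1), because d_e - 1 directions are projected away, and these are almost surely
  linearly independent.\<close>

lemma orthogonal_transformation_borel_measurable:
  fixes f :: "'a::euclidean_space \<Rightarrow> 'a"
  assumes "orthogonal_transformation f"
  shows "f \<in> borel_measurable borel"
  by (intro borel_measurable_continuous_onI linear_continuous_on)
     (use assms in \<open>simp add: linear_conv_bounded_linear[symmetric] orthogonal_transformation_linear\<close>)

text \<open>A translation-invariant measure is a multiple of Lebesgue measure; evaluating at the unit
  ball, which \<open>f\<close> preserves, shows that the multiple is \<open>1\<close>.\<close>

lemma distr_lborel_orthogonal_transformation:
  fixes f :: "'a::euclidean_space \<Rightarrow> 'a"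
  assumes f: "orthogonal_transformation f"
  shows "distr lborel borel f = lborel"
proof (rule measure_eqI)
  define \<nu> where "\<nu> = distr lborel borel f"
  have [measurable]: "f \<in> borel_measurable borel"
    by (rule orthogonal_transformation_borel_measurable[OF f])
  have lin: "linear f" by (simp add: f orthogonal_transformation_linear)
  have nf: "norm (f x) = norm x" for x
    using f by (simp add: orthogonal_transformation_norm)
  have [simp, measurable_cong]: "sets \<nu> = sets borel" and [simp]: "space \<nu> = UNIV"
    by (simp_all add: \<nu>_def)
  have ball: "emeasure \<nu> (ball 0 r) = emeasure lborel (ball (0::'a) r)" for r
  proof -
    have "f -` ball 0 r = ball (0::'a) r" by (auto simp: nf)
    then show ?thesis unfolding \<nu>_def by (subst emeasure_distr) auto
  qed
  interpret \<nu>: sigma_finite_measure \<nu>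
  proof
    show "\<exists>A. countable A \<and> A \<subseteq> sets \<nu> \<and> \<Union> A = space \<nu> \<and> (\<forall>a\<in>A. emeasure \<nu> a \<noteq> \<infinity>)"
    proof (intro exI[of _ "range (\<lambda>n::nat. ball 0 (real n))"] conjI ballI)
      show "\<Union> (range (\<lambda>n::nat. ball 0 (real n))) = space \<nu>"
        using reals_Archimedean2 by fastforce
    next
      fix a assume "a \<in> range (\<lambda>n::nat. ball (0::'a) (real n))"
      then obtain n :: nat where "a = ball 0 (real n)" by auto
      then show "emeasure \<nu> a \<noteq> \<infinity>"
        using emeasure_lborel_ball_finite[of "0::'a" "real n"] by (simp add: ball)
    qed auto
  qed
  interpret P: pair_sigma_finite \<nu> "lborel :: 'a measure" by standard
  have trans\<nu>: "(\<integral>\<^sup>+x. g (x + y) \<partial>\<nu>) = (\<integral>\<^sup>+x. g x \<partial>\<nu>)" if [measurable]: "g \<in> borel_measurable borel" for g y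
  proof -
    obtain z where z: "y = f z" using orthogonal_transformation_surj[OF f] by (meson surjD)
    have "(\<integral>\<^sup>+x. g (x + y) \<partial>\<nu>) = (\<integral>\<^sup>+x. g (f (z + x)) \<partial>lborel)"
      unfolding \<nu>_def by (simp add: nn_integral_distr z linear_add[OF lin] add.commute)
    also have "\<dots> = (\<integral>\<^sup>+x. g (f x) \<partial>distr lborel borel ((+) z))"
      by (simp add: nn_integral_distr)
    also have "\<dots> = (\<integral>\<^sup>+x. g x \<partial>\<nu>)"
      by (simp add: lborel_distr_plus \<nu>_def nn_integral_distr)
    finally show ?thesis .
  qed
  have transl: "(\<integral>\<^sup>+x. g (y + x) \<partial>lborel) = (\<integral>\<^sup>+x. g x \<partial>lborel)" if [measurable]: "g \<in> borel_measurable borel" for g and y :: 'a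
    using nn_integral_distr[of "(+) y" lborel borel g] by (simp add: lborel_distr_plus)
  define B where "B = ball (0::'a) 1"
  have [measurable]: "B \<in> sets borel" by (simp add: B_def)
  show "sets (distr lborel borel f) = sets lborel" by simp
  fix A assume "A \<in> sets (distr lborel borel f)"
  then have [measurable]: "A \<in> sets borel" by simp
  \<comment> \<open>Shifting \<open>x\<close> by \<open>y\<close> under \<nu>, and then
    \<open>y\<close> by \<open>- x\<close> under Lebesgue measure, moves the test for
    \<open>A\<close> to Lebesgue measure and the test for \<open>B\<close> to \<nu>.\<close>
  have "emeasure \<nu> A * emeasure lborel B = (\<integral>\<^sup>+y. \<integral>\<^sup>+x. indicator A x * indicator B y \<partial>\<nu> \<partial>lborel)"
    by (simp add: nn_integral_multc nn_integral_cmult)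
  also have "\<dots> = (\<integral>\<^sup>+y. \<integral>\<^sup>+x. indicator A (x + y) * indicator B y \<partial>\<nu> \<partial>lborel)"
    by (intro nn_integral_cong trans\<nu>[symmetric]) simp
  also have "\<dots> = (\<integral>\<^sup>+x. \<integral>\<^sup>+y. indicator A (x + y) * indicator B y \<partial>lborel \<partial>\<nu>)"
    by (rule P.Fubini') measurable
  also have "\<dots> = (\<integral>\<^sup>+x. \<integral>\<^sup>+y. indicator A y * indicator B (y - x) \<partial>lborel \<partial>\<nu>)"
  proof (rule nn_integral_cong)
    fix x :: 'a
    show "(\<integral>\<^sup>+y. indicator A (x + y) * indicator B y \<partial>lborel) = (\<integral>\<^sup>+y. indicator A y * indicator B (y - x) \<partial>lborel)"
      using transl[of "\<lambda>y. indicator A y * indicator B (y - x)" x] by simp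
  qed
  also have "\<dots> = (\<integral>\<^sup>+y. \<integral>\<^sup>+x. indicator A y * indicator B (y - x) \<partial>\<nu> \<partial>lborel)"
    by (rule P.Fubini'[symmetric]) measurable
  also have "\<dots> = (\<integral>\<^sup>+y. indicator A y * emeasure \<nu> B \<partial>lborel)"
  proof (rule nn_integral_cong)
    fix y :: 'a
    \<comment> \<open>\<open>B\<close> is symmetric about the origin, so \<open>y - x\<close> may be
      replaced by \<open>x - y\<close>, to which the invariance of \<nu> applies.\<close>
    have "(\<integral>\<^sup>+x. indicator B (y - x) \<partial>\<nu>) = (\<integral>\<^sup>+x. indicator B (x + (- y)) \<partial>\<nu>)"
      by (intro nn_integral_cong) (auto simp: B_def indicator_def norm_minus_commute dist_norm)
    also have "\<dots> = emeasure \<nu> B" by (subst trans\<nu>) auto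
    finally show "(\<integral>\<^sup>+x. indicator A y * indicator B (y - x) \<partial>\<nu>) = indicator A y * emeasure \<nu> B"
      by (simp add: nn_integral_cmult)
  qed
  also have "\<dots> = emeasure lborel A * emeasure lborel B"
    by (simp add: nn_integral_multc) (simp add: ball B_def)
  finally have eq: "emeasure \<nu> A * emeasure lborel B = emeasure lborel A * emeasure lborel B" .
  have "emeasure lborel B = ennreal (unit_ball_vol (real DIM('a)))"
    by (simp add: B_def emeasure_ball)
  then have "emeasure lborel B \<noteq> 0" "emeasure lborel B \<noteq> \<top>"
    using unit_ball_vol_pos[of "real DIM('a)"] by (auto simp: ennreal_eq_0_iff not_le)
  with eq have "emeasure \<nu> A = emeasure lborel A"
    by (metis ennreal_mult_divide_eq)
  then show "emeasure (distr lborel borel f) A = emeasure lborel A" by (simp add: \<nu>_def)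
qed

section \<open>The standard Gaussian measure on a Euclidean space\<close>

definition std_gauss :: "'a::euclidean_space measure" where
  "std_gauss = density lborel (\<lambda>x. ennreal ((1 / sqrt (2 * pi)) ^ DIM('a) * exp (- (norm x)\<^sup>2 / 2)))"

lemma sets_std_gauss [simp, measurable_cong]: "sets std_gauss = sets borel"
  and space_std_gauss [simp]: "space std_gauss = UNIV"
  by (simp_all add: std_gauss_def)

lemma prod_std_normal_density:
  assumes "finite I"
  shows "(\<Prod>i\<in>I. std_normal_density (x i)) = (1 / sqrt (2 * pi)) ^ card I * exp (- (\<Sum>i\<in>I. (x i)\<^sup>2) / 2)"
  using assms
  by (simp add: std_normal_density_def prod.distrib prod_dividef power_one_over exp_sum[symmetric] sum_negf sum_divide_distrib divide_simps prod_constant)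

text \<open>The two forms of the density serve different ends: the one through the norm displays
  rotation invariance, this one displays independent coordinates and hence gives the total mass and
  the link to independent matrix entries.\<close>

lemma std_gauss_eq_density_prod:
  "(std_gauss :: 'a::euclidean_space measure) = density lborel (\<lambda>x. \<Prod>b\<in>Basis. ennreal (std_normal_density (x \<bullet> b)))"
proof -
  have "(norm x)\<^sup>2 = (\<Sum>b\<in>Basis. (x \<bullet> b)\<^sup>2)" for x :: 'a
    unfolding power2_norm_eq_inner by (subst euclidean_inner) (simp add: power2_eq_square)
  then have "(1 / sqrt (2 * pi)) ^ DIM('a) * exp (- (norm x)\<^sup>2 / 2) = (\<Prod>b\<in>Basis. std_normal_density (x \<bullet> b))" for x :: 'a
    using prod_std_normal_density[of "Basis :: 'a set" "\<lambda>b. x \<bullet> b"] by simp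
  then show ?thesis
    unfolding std_gauss_def by (simp add: prod_ennreal)
qed

lemma prob_space_std_gauss: "prob_space (std_gauss :: 'a::euclidean_space measure)"
proof
  have 1: "(\<integral>\<^sup>+x. ennreal (std_normal_density x) \<partial>lborel) = 1"
  proof -
    interpret prob_space "density lborel std_normal_density"
      by (rule prob_space_normal_density) simp
    show ?thesis using emeasure_space_1 by (simp add: emeasure_density)
  qed
  have "emeasure (std_gauss :: 'a measure) (space std_gauss) =
      (\<integral>\<^sup>+x. (\<Prod>b\<in>Basis. ennreal (std_normal_density (x \<bullet> b))) \<partial>(lborel :: 'a measure))"
    by (simp add: std_gauss_eq_density_prod emeasure_density)
  also have "\<dots> = (\<Prod>b\<in>(Basis :: 'a set). \<integral>\<^sup>+x. ennreal (std_normal_density x) \<partial>lborel)"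
    by (subst nn_integral_lborel_prod) auto
  finally show "emeasure (std_gauss :: 'a measure) (space std_gauss) = 1" by (simp add: 1)
qed

lemma distr_std_gauss_orthogonal_transformation:
  fixes f :: "'a::euclidean_space \<Rightarrow> 'a"
  assumes f: "orthogonal_transformation f"
  shows "distr std_gauss borel f = std_gauss"
proof -
  have [measurable]: "f \<in> borel_measurable borel"
    by (rule orthogonal_transformation_borel_measurable[OF f])
  have nf: "norm (f x) = norm x" for x
    using f by (simp add: orthogonal_transformation_norm)
  have "std_gauss = density (distr lborel borel f) (\<lambda>x. ennreal ((1 / sqrt (2 * pi)) ^ DIM('a) * exp (- (norm x)\<^sup>2 / 2)))"
    by (simp add: distr_lborel_orthogonal_transformation[OF f] std_gauss_def)
  also have "\<dots> = distr std_gauss borel f"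
    by (subst density_distr) (simp_all add: std_gauss_def nf)
  finally show ?thesis ..
qed

lemma AE_std_gauss:
  fixes P :: "'a::euclidean_space \<Rightarrow> bool"
  assumes "AE x in lborel. P x"
  shows "AE x in std_gauss. P x"
  using assms unfolding std_gauss_def by (subst AE_density) auto

text \<open>On a box the integrand is a product of functions of one coordinate each, so the integral
  factorises; the values on boxes determine a product measure.\<close>

lemma (in product_sigma_finite) density_PiM:
  assumes I: "finite I" and f [measurable]: "\<And>i. i \<in> I \<Longrightarrow> f i \<in> borel_measurable (M i)"
    and sf: "\<And>i. sigma_finite_measure (density (M i) (f i))"
  shows "density (PiM I M) (\<lambda>x. \<Prod>i\<in>I. f i (x i)) = PiM I (\<lambda>i. density (M i) (f i))"
proof -
  interpret D: product_sigma_finite "\<lambda>i. density (M i) (f i)"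
    using sf by (simp add: product_sigma_finite_def)
  show ?thesis
  proof (rule D.PiM_eqI[OF I])
    show "sets (density (PiM I M) (\<lambda>x. \<Prod>i\<in>I. f i (x i))) = sets (PiM I (\<lambda>i. density (M i) (f i)))"
      by (simp cong: sets_PiM_cong)
  next
    fix A assume "\<And>i. i \<in> I \<Longrightarrow> A i \<in> sets (density (M i) (f i))"
    then have A [measurable]: "\<And>i. i \<in> I \<Longrightarrow> A i \<in> sets (M i)" by simp
    have [measurable]: "Pi\<^sub>E I A \<in> sets (PiM I M)" using I A by (intro sets_PiM_I_finite) auto
    have [measurable]: "(\<lambda>x. \<Prod>i\<in>I. f i (x i)) \<in> borel_measurable (PiM I M)" using I by measurable
    have "emeasure (density (PiM I M) (\<lambda>x. \<Prod>i\<in>I. f i (x i))) (Pi\<^sub>E I A) =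
        (\<integral>\<^sup>+x. (\<Prod>i\<in>I. f i (x i)) * indicator (Pi\<^sub>E I A) x \<partial>PiM I M)"
      by (simp add: emeasure_density)
    also have "\<dots> = (\<integral>\<^sup>+x. (\<Prod>i\<in>I. f i (x i) * indicator (A i) (x i)) \<partial>PiM I M)"
    proof (rule nn_integral_cong)
      fix x assume "x \<in> space (PiM I M)"
      then have "indicator (Pi\<^sub>E I A) x = (\<Prod>i\<in>I. indicator (A i) (x i) :: ennreal)"
        using I by (auto simp: indicator_def PiE_iff space_PiM prod_eq_1_iff intro!: prod_zero)
      then show "(\<Prod>i\<in>I. f i (x i)) * indicator (Pi\<^sub>E I A) x = (\<Prod>i\<in>I. f i (x i) * indicator (A i) (x i))"
        by (simp add: prod.distrib)
    qed
    also have "\<dots> = (\<Prod>i\<in>I. \<integral>\<^sup>+x. f i x * indicator (A i) x \<partial>M i)"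
      by (rule product_nn_integral_prod[OF I]) auto
    also have "\<dots> = (\<Prod>i\<in>I. emeasure (density (M i) (f i)) (A i))"
      by (intro prod.cong) (simp_all add: emeasure_density)
    finally show "emeasure (density (PiM I M) (\<lambda>x. \<Prod>i\<in>I. f i (x i))) (Pi\<^sub>E I A) =
      (\<Prod>i\<in>I. emeasure (density (M i) (f i)) (A i))" .
  qed
qed

abbreviation "std_normal \<equiv> density lborel (\<lambda>x. ennreal (std_normal_density x))"

lemma prob_space_std_normal: "prob_space std_normal"
  by (rule prob_space_normal_density) simp

lemma PiM_std_normal:
  assumes "finite I"
  shows "PiM I (\<lambda>_. std_normal) = density (PiM I (\<lambda>_. lborel)) (\<lambda>x. \<Prod>i\<in>I. ennreal (std_normal_density (x i)))"
proof -
  interpret product_sigma_finite "\<lambda>_. lborel :: real measure" by standard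
  show ?thesis
    using assms prob_space_imp_sigma_finite[OF prob_space_std_normal]
    by (intro density_PiM[symmetric]) auto
qed

lemma std_gauss_eq_distr_PiM:
  "(std_gauss :: 'a::euclidean_space measure) =
    distr (PiM Basis (\<lambda>_. std_normal)) borel (\<lambda>f. \<Sum>b\<in>Basis. f b *\<^sub>R b)"
proof -
  have "(std_gauss :: 'a measure) = density (distr (PiM Basis (\<lambda>_. lborel)) borel (\<lambda>f. \<Sum>b\<in>Basis. f b *\<^sub>R b))
     (\<lambda>x. \<Prod>b\<in>Basis. ennreal (std_normal_density (x \<bullet> b)))"
    by (simp add: std_gauss_eq_density_prod lborel_eq[symmetric])
  also have "\<dots> = distr (density (PiM Basis (\<lambda>_. lborel))
      (\<lambda>f. \<Prod>b\<in>Basis. ennreal (std_normal_density ((\<Sum>b\<in>Basis. f b *\<^sub>R b :: 'a) \<bullet> b)))) borel (\<lambda>f. \<Sum>b\<in>Basis. f b *\<^sub>R b)"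
    by (subst density_distr) auto
  also have "\<dots> = distr (PiM Basis (\<lambda>_. std_normal)) borel (\<lambda>f. \<Sum>b\<in>Basis. f b *\<^sub>R b)"
    by (simp add: PiM_std_normal)
  finally show ?thesis .
qed

text \<open>Squared norms add in a product space, so the densities multiply to one of the same
  shape. An independent pair thereby becomes a single Gaussian vector, on which orthogonal maps may
  mix the two components.\<close>

lemma std_gauss_pair:
  "(std_gauss :: 'a::euclidean_space measure) \<Otimes>\<^sub>M (std_gauss :: 'b::euclidean_space measure) = std_gauss"
proof -
  have sf: "sigma_finite_measure (std_gauss :: 'b measure)"
    by (rule prob_space_imp_sigma_finite[OF prob_space_std_gauss])
  have [measurable]: "fst \<in> borel_measurable (borel :: ('a \<times> 'b) measure)" "snd \<in> borel_measurable (borel :: ('a \<times> 'b) measure)"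
    by (simp_all add: borel_prod[symmetric])
  have "(std_gauss :: 'a measure) \<Otimes>\<^sub>M (std_gauss :: 'b measure) =
    density (lborel \<Otimes>\<^sub>M lborel) (\<lambda>(x, y). ennreal ((1 / sqrt (2 * pi)) ^ DIM('a) * exp (- (norm x)\<^sup>2 / 2)) *
       ennreal ((1 / sqrt (2 * pi)) ^ DIM('b) * exp (- (norm y)\<^sup>2 / 2)))"
    using sf unfolding std_gauss_def by (intro pair_measure_density) (auto intro: sigma_finite_lborel)
  also have "\<dots> = std_gauss"
    unfolding std_gauss_def lborel_prod
  proof (rule density_cong)
    show "(\<lambda>(x, y). ennreal ((1 / sqrt (2 * pi)) ^ DIM('a) * exp (- (norm x)\<^sup>2 / 2)) *
        ennreal ((1 / sqrt (2 * pi)) ^ DIM('b) * exp (- (norm y)\<^sup>2 / 2))) \<in> borel_measurable (lborel :: ('a \<times> 'b) measure)"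
      by (simp add: split_beta)
  qed (auto simp: ennreal_mult'[symmetric] norm_Pair power_add exp_add[symmetric] field_simps intro!: AE_I2)
  finally show ?thesis .
qed

section \<open>Measures determined by balls, and by the law of the norm\<close>

text \<open>Convolving with the uniform distribution on a small ball \<open>ball 0 \<epsilon>\<close> turns the masses of balls
  into approximations of the mass of a closed set.\<close>

lemma measure_eqI_balls:
  fixes \<mu> \<nu> :: "'a::euclidean_space measure"
  assumes "finite_measure \<mu>" "finite_measure \<nu>"
    and [measurable_cong]: "sets \<mu> = sets borel" "sets \<nu> = sets borel"
    and ball: "\<And>x r. emeasure \<mu> (ball x r) = emeasure \<nu> (ball x r)"
  shows "\<mu> = \<nu>"
proof -
  interpret \<mu>: finite_measure \<mu> by fact
  have closed: "emeasure \<mu> C = emeasure \<nu> C" if C: "closed C" "C \<noteq> {}" for C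
  proof -
    define \<epsilon> where "\<epsilon> k = 1 / real (Suc k)" for k
    have \<epsilon>: "\<epsilon> k > 0" for k by (simp add: \<epsilon>_def)
    define U where "U k = {x. infdist x C < \<epsilon> k}" for k
    have U [measurable]: "U k \<in> sets borel" for k
      unfolding U_def by (intro borel_open open_Collect_less continuous_intros)
    \<comment> \<open>The fraction of the ball about \<open>w\<close> that lies in the neighbourhood
      \<open>U k\<close> of \<open>C\<close>. It is 1 on \<open>C\<close>, and off \<open>C\<close>
      it is 0 as soon as \<open>\<epsilon> k\<close> is below half the distance to
      \<open>C\<close>.\<close>
    define \<phi> where "\<phi> k w = emeasure lborel (ball w (\<epsilon> k) \<inter> U k) / emeasure lborel (ball (0::'a) (\<epsilon> k))" for k w
    have vol: "emeasure lborel (ball w (\<epsilon> k)) = emeasure lborel (ball (0::'a) (\<epsilon> k))" for w :: 'a and k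
      using \<epsilon>[of k] by (simp add: emeasure_ball less_imp_le)
    have vol0: "emeasure lborel (ball (0::'a) (\<epsilon> k)) \<noteq> 0" "emeasure lborel (ball (0::'a) (\<epsilon> k)) \<noteq> \<top>" for k
      using \<epsilon>[of k] unit_ball_vol_pos[of "real DIM('a)"]
      by (auto simp: emeasure_ball less_imp_le ennreal_eq_0_iff not_le)
    have \<phi>_int: "\<phi> k w = (\<integral>\<^sup>+s. indicator (U k) s * (if dist w s < \<epsilon> k then 1 else 0) \<partial>lborel) / emeasure lborel (ball (0::'a) (\<epsilon> k))" for k w
    proof -
      have "emeasure lborel (ball w (\<epsilon> k) \<inter> U k) = (\<integral>\<^sup>+s. indicator (ball w (\<epsilon> k) \<inter> U k) s \<partial>lborel)"
        by simp
      also have "\<dots> = (\<integral>\<^sup>+s. indicator (U k) s * (if dist w s < \<epsilon> k then 1 else 0) \<partial>lborel)"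
        by (intro nn_integral_cong) (auto simp: indicator_def)
      finally show ?thesis by (simp add: \<phi>_def)
    qed
    have \<phi>_meas [measurable]: "\<phi> k \<in> borel_measurable borel" for k
      unfolding \<phi>_int[abs_def] by measurable
    have int_eq: "(\<integral>\<^sup>+w. \<phi> k w \<partial>\<mu>) = (\<integral>\<^sup>+w. \<phi> k w \<partial>\<nu>)" for k
    proof -
      \<comment> \<open>The relation \<open>dist w s < \<epsilon> k\<close> is symmetric, so after
        Fubini the inner integral is the \<xi>-mass of a ball about \<open>s\<close>. Thus \<xi>
        enters only through masses of balls, where \<mu> and \<nu> agree.\<close>
      have gen: "(\<integral>\<^sup>+w. \<phi> k w \<partial>\<xi>) = (\<integral>\<^sup>+s. indicator (U k) s * emeasure \<xi> (ball s (\<epsilon> k)) \<partial>lborel) / emeasure lborel (ball (0::'a) (\<epsilon> k))"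
        if "finite_measure \<xi>" and [measurable_cong]: "sets \<xi> = sets borel" for \<xi> :: "'a measure"
      proof -
        interpret \<xi>: finite_measure \<xi> by fact
        interpret P\<xi>: pair_sigma_finite \<xi> "lborel :: 'a measure" by standard
        have [simp]: "space \<xi> = UNIV" using sets_eq_imp_space_eq[OF that(2)] by simp
        have "(\<integral>\<^sup>+w. \<phi> k w \<partial>\<xi>) = (\<integral>\<^sup>+w. \<integral>\<^sup>+s. indicator (U k) s * (if dist w s < \<epsilon> k then 1 else 0) \<partial>lborel \<partial>\<xi>) / emeasure lborel (ball (0::'a) (\<epsilon> k))"
          unfolding \<phi>_int by (subst nn_integral_divide) auto
        also have "(\<integral>\<^sup>+w. \<integral>\<^sup>+s. indicator (U k) s * (if dist w s < \<epsilon> k then 1 else 0) \<partial>lborel \<partial>\<xi>)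
          = (\<integral>\<^sup>+s. \<integral>\<^sup>+w. indicator (U k) s * (if dist w s < \<epsilon> k then 1 else 0) \<partial>\<xi> \<partial>lborel)"
          by (rule P\<xi>.Fubini'[symmetric]) measurable
        also have "\<dots> = (\<integral>\<^sup>+s. indicator (U k) s * emeasure \<xi> (ball s (\<epsilon> k)) \<partial>lborel)"
        proof (rule nn_integral_cong)
          fix s :: 'a
          have "(\<integral>\<^sup>+w. indicator (U k) s * (if dist w s < \<epsilon> k then 1 else 0) \<partial>\<xi>) = (\<integral>\<^sup>+w. indicator (U k) s * indicator (ball s (\<epsilon> k)) w \<partial>\<xi>)"
            by (intro nn_integral_cong) (auto simp: indicator_def dist_commute)
          also have "\<dots> = indicator (U k) s * (\<integral>\<^sup>+w. indicator (ball s (\<epsilon> k)) w \<partial>\<xi>)"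
            by (rule nn_integral_cmult) (simp add: that(2) borel_measurable_indicator)
          finally show "(\<integral>\<^sup>+w. indicator (U k) s * (if dist w s < \<epsilon> k then 1 else 0) \<partial>\<xi>) = indicator (U k) s * emeasure \<xi> (ball s (\<epsilon> k))"
            using that(2) by simp
        qed
        finally show ?thesis .
      qed
      show ?thesis
        using gen[of \<mu>] gen[of \<nu>] assms by simp
    qed
    have lim: "(\<lambda>k. \<phi> k w) \<longlonglongrightarrow> indicator C w" for w
    proof (cases "w \<in> C")
      case True
      have "\<phi> k w = 1" for k
      proof -
        have "ball w (\<epsilon> k) \<inter> U k = ball w (\<epsilon> k)"
          by (auto simp: U_def dist_commute intro!: le_less_trans[OF infdist_le[OF True]])
        then show ?thesis
          using ennreal_divide_self[OF vol0(1) vol0(2)[unfolded less_top]] by (simp add: \<phi>_def vol[of w])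
      qed
      then show ?thesis using True by simp
    next
      case False
      then have pos: "infdist w C > 0"
        using C by (metis in_closed_iff_infdist_zero infdist_nonneg less_eq_real_def)
      have "\<epsilon> \<longlonglongrightarrow> 0" unfolding \<epsilon>_def[abs_def] by (rule LIMSEQ_Suc[OF lim_1_over_n])
      then have "\<forall>\<^sub>F k in sequentially. \<epsilon> k < infdist w C / 2"
        using pos by (intro order_tendstoD) auto
      then have "\<forall>\<^sub>F k in sequentially. \<phi> k w = indicator C w"
      proof eventually_elim
        case (elim k)
        have "ball w (\<epsilon> k) \<inter> U k = {}"
        proof (rule ccontr)
          assume "ball w (\<epsilon> k) \<inter> U k \<noteq> {}"
          then obtain s where "dist w s < \<epsilon> k" "infdist s C < \<epsilon> k" by (auto simp: U_def)
          then show False using infdist_triangle[of w C s] elim by simp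
        qed
        then show ?case using False by (simp add: \<phi>_def)
      qed
      then show ?thesis by (rule tendsto_eventually)
    qed
    have le1: "\<phi> k w \<le> 1" for k w
    proof -
      have "emeasure lborel (ball w (\<epsilon> k) \<inter> U k) \<le> emeasure lborel (ball (0::'a) (\<epsilon> k))"
        unfolding vol[of w k, symmetric] by (intro emeasure_mono) auto
      then show ?thesis unfolding \<phi>_def by (intro divide_le_posI_ennreal) (use vol0[of k] in \<open>auto simp: zero_less_iff_neq_zero\<close>)
    qed
    have conv: "(\<lambda>k. \<integral>\<^sup>+w. \<phi> k w \<partial>\<xi>) \<longlonglongrightarrow> emeasure \<xi> C" if "finite_measure \<xi>" and [measurable_cong]: "sets \<xi> = sets borel" for \<xi> :: "'a measure"
    proof -
      interpret \<xi>: finite_measure \<xi> by fact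
      have "(\<lambda>k. \<integral>\<^sup>+w. \<phi> k w \<partial>\<xi>) \<longlonglongrightarrow> (\<integral>\<^sup>+w. indicator C w \<partial>\<xi>)"
        using C(1) lim le1 by (intro nn_integral_dominated_convergence[where w = "\<lambda>_. 1"])
          (auto simp: \<xi>.emeasure_eq_measure that(2) intro!: borel_measurable_indicator)
      then show ?thesis using C(1) that(2) by simp
    qed
    have "(\<lambda>k. \<integral>\<^sup>+w. \<phi> k w \<partial>\<nu>) \<longlonglongrightarrow> emeasure \<mu> C"
      using conv[OF assms(1,3)] by (simp add: int_eq)
    then show ?thesis by (rule LIMSEQ_unique[OF _ conv[OF assms(2,4)]])
  qed
  show ?thesis
  proof (rule measure_eqI_generator_eq[where \<Omega> = UNIV and E = "Collect closed" and A = "\<lambda>_. UNIV"])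
    show "Int_stable (Collect (closed :: 'a set \<Rightarrow> bool))" by (auto simp: Int_stable_def)
    show "emeasure \<mu> X = emeasure \<nu> X" if "X \<in> Collect closed" for X
      using closed[of X] that by (cases "X = {}") auto
    show "sets \<mu> = sigma_sets UNIV (Collect closed)" "sets \<nu> = sigma_sets UNIV (Collect closed)"
      by (simp_all add: assms borel_eq_closed)
  qed (auto simp: \<mu>.emeasure_eq_measure)
qed

text \<open>Averaging over the direction: the mass of \<open>ball s r\<close> equals the mean over a rotation-invariant
  random direction \<open>u\<close> of the mass of \<open>ball (norm s *\<^sub>R u) r\<close>, and by Fubini this is the integral of
  a function of the norm only.\<close>

lemma rotation_invariant_measure_eqI:
  fixes \<mu> \<nu> :: "(real ^ 'n) measure"
  assumes "finite_measure \<mu>" "finite_measure \<nu>"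
    and sets: "sets \<mu> = sets borel" "sets \<nu> = sets borel"
    and inv: "\<And>f. orthogonal_transformation f \<Longrightarrow> distr \<mu> borel f = \<mu>"
      "\<And>f. orthogonal_transformation f \<Longrightarrow> distr \<nu> borel f = \<nu>"
    and norm: "distr \<mu> borel norm = distr \<nu> borel norm"
  shows "\<mu> = \<nu>"
proof (rule measure_eqI_balls[OF assms(1-4)])
  fix s :: "real ^ 'n" and r :: real
  define e :: "real ^ 'n" where "e = axis (SOME i. True) 1"
  have e: "norm e = 1" by (simp add: e_def)
  \<comment> \<open>The random direction is that of a Gaussian \<open>x\<close>, which is almost
    surely non-zero. \<open>D w x\<close> says that \<open>w\<close> lies in the ball of radius
    \<open>r\<close> about the point of length \<open>norm s\<close> in the direction of
    \<open>x\<close>.\<close>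
  define D where "D w x \<longleftrightarrow> dist ((norm s / norm x) *\<^sub>R x) w < r" for w x :: "real ^ 'n"
  define \<Psi> where "\<Psi> w = (\<integral>\<^sup>+x. (if D w x then 1 else 0) \<partial>(std_gauss :: (real ^ 'n) measure))" for w
  have D_meas [measurable]: "Measurable.pred (borel \<Otimes>\<^sub>M borel) (\<lambda>(w, x). D w x)"
    unfolding D_def by measurable
  interpret G: prob_space "std_gauss :: (real ^ 'n) measure" by (rule prob_space_std_gauss)
  have [measurable]: "\<Psi> \<in> borel_measurable borel" unfolding \<Psi>_def by measurable
  \<comment> \<open>Rotating \<open>w\<close> and \<open>x\<close> together leaves \<open>D\<close>
    unchanged, and the law of \<open>x\<close> absorbs the rotation; hence \<open>\<Psi> w\<close>
    depends on \<open>norm w\<close> only. The unit vector \<open>e\<close> is an arbitrary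
    reference direction.\<close>
  have \<Psi>: "\<Psi> w = \<Psi> (norm w *\<^sub>R e)" for w
  proof -
    obtain R where R: "orthogonal_transformation R" "R w = norm w *\<^sub>R e"
      using orthogonal_transformation_exists[of w "norm w *\<^sub>R e"] e by auto
    have [measurable]: "R \<in> borel_measurable borel"
      by (rule orthogonal_transformation_borel_measurable[OF R(1)])
    have "D (R w) (R x) = D w x" for x
      using R(1) by (simp add: D_def orthogonal_transformation_norm dist_norm
          orthogonal_transformation_scaleR[OF R(1), symmetric]
          linear_diff[OF orthogonal_transformation_linear[OF R(1)], symmetric])
    then have "\<Psi> w = (\<integral>\<^sup>+x. (if D (R w) (R x) then 1 else 0) \<partial>std_gauss)"
      by (simp add: \<Psi>_def)
    also have "\<dots> = (\<integral>\<^sup>+x. (if D (R w) x then 1 else 0) \<partial>distr std_gauss borel R)"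
      by (subst nn_integral_distr) auto
    also have "\<dots> = \<Psi> (R w)"
      by (simp add: distr_std_gauss_orthogonal_transformation[OF R(1)] \<Psi>_def)
    finally show ?thesis by (simp add: R(2))
  qed
  have main: "emeasure \<xi> (ball s r) = (\<integral>\<^sup>+t. \<Psi> (t *\<^sub>R e) \<partial>distr \<xi> borel norm)"
    if "finite_measure \<xi>" and sets' [measurable_cong]: "sets \<xi> = sets borel"
      and inv': "\<And>f. orthogonal_transformation f \<Longrightarrow> distr \<xi> borel f = \<xi>" for \<xi> :: "(real ^ 'n) measure"
  proof -
    interpret \<xi>: finite_measure \<xi> by fact
    interpret P: pair_sigma_finite \<xi> "std_gauss :: (real ^ 'n) measure" by standard
    have [simp]: "space \<xi> = UNIV" using sets_eq_imp_space_eq[OF sets'] by simp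
    \<comment> \<open>A rotation takes \<open>s\<close> to the point of the same length in direction
      \<open>x\<close>, hence one ball to the other. The inner integral is therefore the same for
      every direction.\<close>
    have dir: "emeasure \<xi> (ball s r) = (\<integral>\<^sup>+w. (if D w x then 1 else 0) \<partial>\<xi>)" if "x \<noteq> 0" for x
    proof -
      obtain R where R: "orthogonal_transformation R" "R s = (norm s / norm x) *\<^sub>R x"
        using orthogonal_transformation_exists[of s "(norm s / norm x) *\<^sub>R x"] \<open>x \<noteq> 0\<close> by auto
      have [measurable]: "R \<in> borel_measurable borel"
        by (rule orthogonal_transformation_borel_measurable[OF R(1)])
      have "(\<integral>\<^sup>+w. (if D w x then 1 else 0) \<partial>\<xi>) = (\<integral>\<^sup>+w. indicator (ball (R s) r) w \<partial>\<xi>)"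
        by (intro nn_integral_cong) (auto simp: D_def R(2) indicator_def)
      also have "\<dots> = emeasure (distr \<xi> borel R) (ball (R s) r)"
        by (simp add: inv'[OF R(1)] sets')
      also have "\<dots> = emeasure \<xi> (R -` ball (R s) r)"
        by (subst emeasure_distr) auto
      also have "R -` ball (R s) r = ball s r"
        by (auto simp: dist_norm linear_diff[OF orthogonal_transformation_linear[OF R(1)], symmetric]
            orthogonal_transformation_norm[OF R(1)])
      finally show ?thesis ..
    qed
    have "AE x in std_gauss. x \<noteq> (0 :: real ^ 'n)"
      by (intro AE_std_gauss AE_lborel_singleton)
    then have "AE x in std_gauss. emeasure \<xi> (ball s r) = (\<integral>\<^sup>+w. (if D w x then 1 else 0) \<partial>\<xi>)"
      by eventually_elim (rule dir)
    then have "(\<integral>\<^sup>+x. emeasure \<xi> (ball s r) \<partial>(std_gauss :: (real ^ 'n) measure)) =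
      (\<integral>\<^sup>+x. \<integral>\<^sup>+w. (if D w x then 1 else 0) \<partial>\<xi> \<partial>std_gauss)"
      by (rule nn_integral_cong_AE)
    also have "\<dots> = (\<integral>\<^sup>+w. \<Psi> w \<partial>\<xi>)"
      unfolding \<Psi>_def by (rule P.Fubini') measurable
    also have "\<dots> = (\<integral>\<^sup>+w. \<Psi> (norm w *\<^sub>R e) \<partial>\<xi>)"
      by (subst \<Psi>) simp
    also have "\<dots> = (\<integral>\<^sup>+t. \<Psi> (t *\<^sub>R e) \<partial>distr \<xi> borel norm)"
      by (subst nn_integral_distr) auto
    finally show ?thesis
      using G.emeasure_space_1 by simp
  qed
  show "emeasure \<mu> (ball s r) = emeasure \<nu> (ball s r)"
    using main[OF assms(1) sets(1) inv(1)] main[OF assms(2) sets(2) inv(2)] by (simp add: norm)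
qed

section \<open>Orthonormal families and orthogonal projection\<close>

text \<open>Adjoin to \<open>B\<close> an orthonormal basis of its orthogonal complement.\<close>

lemma orthonormal_extend:
  fixes B :: "'a::euclidean_space set"
  assumes B: "pairwise orthogonal B" "\<And>x. x \<in> B \<Longrightarrow> norm x = 1"
  obtains C where "B \<subseteq> C" "pairwise orthogonal C" "\<And>x. x \<in> C \<Longrightarrow> norm x = 1" "finite C" "card C = DIM('a)" "span C = UNIV"
proof -
  obtain D where D: "D \<subseteq> B\<^sup>\<bottom>" "pairwise orthogonal D" "\<And>x. x \<in> D \<Longrightarrow> norm x = 1" "span D = B\<^sup>\<bottom>"
    using orthonormal_basis_subspace[OF subspace_orthogonal_comp[of B]] by metis
  have "orthogonal b d" if "b \<in> B" "d \<in> D" for b d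
    using that D(1) by (auto simp: orthogonal_comp_def)
  then have orth: "pairwise orthogonal (B \<union> D)"
    using B(1) D(2) unfolding pairwise_def by (metis UnE orthogonal_commute)
  have norm1: "norm x = 1" if "x \<in> B \<union> D" for x using that B(2) D(3) by blast
  have ind: "independent (B \<union> D)"
    using orth norm1[of 0] by (intro pairwise_orthogonal_independent) auto
  have "x \<in> span (B \<union> D)" for x
  proof -
    obtain y z where yz: "y \<in> span B" "\<And>w. w \<in> span B \<Longrightarrow> orthogonal z w" "x = y + z"
      using orthogonal_subspace_decomp_exists[of B x] by metis
    then have "z \<in> B\<^sup>\<bottom>" by (auto simp: orthogonal_comp_def orthogonal_commute span_base)
    then show ?thesis
      unfolding yz(3) using yz(1) D(4) span_mono[of B "B \<union> D"] span_mono[of D "B \<union> D"]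
      by (intro span_add) blast+
  qed
  then have span: "span (B \<union> D) = UNIV" by auto
  have "card (B \<union> D) = DIM('a)"
    using indep_card_eq_dim_span[OF ind] span by simp
  show thesis
  proof (rule that)
    show "norm x = 1" if "x \<in> B \<union> D" for x by (rule norm1[OF that])
  qed (use orth span pairwise_orthogonal_imp_finite[OF orth] \<open>card (B \<union> D) = DIM('a)\<close> in auto)
qed

text \<open>An orthonormal basis is indexed by the standard basis, not given as a bare set, so that
  taking coordinates with respect to it is a map of the space to itself.\<close>

definition orthonormal_family :: "('a::euclidean_space \<Rightarrow> 'a) \<Rightarrow> bool" where
  "orthonormal_family \<sigma> \<longleftrightarrow> (\<forall>b\<in>Basis. \<forall>c\<in>Basis. \<sigma> b \<bullet> \<sigma> c = (if b = c then 1 else 0))"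

text \<open>A prescribed orthonormal set is made to occupy a definite set \<open>J\<close> of
  coordinate positions, so that projecting along its span becomes deleting the coordinates in
  \<open>J\<close>.\<close>

lemma orthonormal_family_exists:
  fixes B :: "'a::euclidean_space set"
  assumes B: "pairwise orthogonal B" "\<And>x. x \<in> B \<Longrightarrow> norm x = 1"
  obtains \<sigma> J where "orthonormal_family \<sigma>" "J \<subseteq> Basis" "bij_betw \<sigma> J B"
proof -
  obtain C where C: "B \<subseteq> C" "pairwise orthogonal C" "\<And>x. x \<in> C \<Longrightarrow> norm x = 1" "finite C" "card C = DIM('a)"
    using orthonormal_extend[OF B] by metis
  obtain \<sigma> where \<sigma>: "bij_betw \<sigma> (Basis :: 'a set) C"
    using finite_same_card_bij[of "Basis :: 'a set" C] C by auto
  have "orthonormal_family \<sigma>"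
    unfolding orthonormal_family_def
  proof (intro ballI)
    fix b c :: 'a assume bc: "b \<in> Basis" "c \<in> Basis"
    then have "\<sigma> b \<in> C" "\<sigma> c \<in> C" "\<sigma> b = \<sigma> c \<longleftrightarrow> b = c"
      using \<sigma> by (auto simp: bij_betw_def inj_on_eq_iff)
    then show "\<sigma> b \<bullet> \<sigma> c = (if b = c then 1 else 0)"
      using C(2) C(3)[of "\<sigma> b"] by (auto simp: pairwise_def orthogonal_def norm_eq_1)
  qed
  moreover have "bij_betw \<sigma> (Basis \<inter> \<sigma> -` B) B"
    using \<sigma> C(1) by (auto simp: bij_betw_def inj_on_def image_iff) blast
  ultimately show ?thesis using that[of \<sigma> "Basis \<inter> \<sigma> -` B"] by auto
qed

lemma orthonormal_family_expand:
  fixes x :: "'a::euclidean_space"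
  assumes "orthonormal_family \<sigma>"
  shows "(\<Sum>b\<in>Basis. (x \<bullet> \<sigma> b) *\<^sub>R \<sigma> b) = x"
proof -
  have inj: "inj_on \<sigma> (Basis :: 'a set)"
    using assms unfolding inj_on_def orthonormal_family_def by (metis zero_neq_one)
  have orth: "pairwise orthogonal (\<sigma> ` (Basis :: 'a set))"
    using assms by (auto simp: pairwise_def orthogonal_def orthonormal_family_def)
  have nrm: "norm y = 1" if "y \<in> \<sigma> ` (Basis :: 'a set)" for y
    using that assms by (auto simp: norm_eq_1 orthonormal_family_def)
  have "independent (\<sigma> ` (Basis :: 'a set))"
    using orth nrm[of 0] by (intro pairwise_orthogonal_independent) auto
  then have "dim (\<sigma> ` (Basis :: 'a set)) = DIM('a)"
    using inj by (simp add: dim_eq_card_independent card_image)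
  then have "span (\<sigma> ` (Basis :: 'a set)) = UNIV" by (simp add: dim_eq_full)
  then show ?thesis
    using orthonormal_basis_expand[OF orth nrm, of x] by (simp add: sum.reindex[OF inj])
qed

lemma orthonormal_family_inner:
  fixes x :: "'a::euclidean_space"
  assumes "orthonormal_family \<sigma>"
  shows "(\<Sum>b\<in>Basis. (x \<bullet> \<sigma> b) * (y \<bullet> \<sigma> b)) = x \<bullet> y"
proof -
  have "y \<bullet> x = y \<bullet> (\<Sum>b\<in>Basis. (x \<bullet> \<sigma> b) *\<^sub>R \<sigma> b)"
    by (simp add: orthonormal_family_expand[OF assms])
  then show ?thesis by (simp add: inner_sum_right inner_commute)
qed

text \<open>Parseval's identity for the family says exactly that reading off its coordinates
  preserves inner products.\<close>

lemma orthonormal_family_orthogonal_transformation: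
  assumes "orthonormal_family \<sigma>"
  shows "orthogonal_transformation (\<lambda>x::'a::euclidean_space. \<Sum>b\<in>Basis. (x \<bullet> \<sigma> b) *\<^sub>R b)"
  unfolding orthogonal_transformation_def
proof (intro conjI allI)
  show "linear (\<lambda>x::'a. \<Sum>b\<in>Basis. (x \<bullet> \<sigma> b) *\<^sub>R b)"
    by (intro linear_compose_sum ballI linearI) (auto simp: inner_add_left scaleR_add_left)
  fix v w :: 'a
  have "(\<Sum>b\<in>Basis. (v \<bullet> \<sigma> b) *\<^sub>R b) \<bullet> (\<Sum>b\<in>Basis. (w \<bullet> \<sigma> b) *\<^sub>R b) = (\<Sum>b\<in>Basis. (v \<bullet> \<sigma> b) * (w \<bullet> \<sigma> b))"
    by (subst euclidean_inner) simp
  then show "(\<Sum>b\<in>Basis. (v \<bullet> \<sigma> b) *\<^sub>R b) \<bullet> (\<Sum>b\<in>Basis. (w \<bullet> \<sigma> b) *\<^sub>R b) = v \<bullet> w"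
    by (simp add: orthonormal_family_inner[OF assms])
qed

section \<open>Gram-Schmidt components of vectors\<close>

text \<open>The component of \<open>a\<close> orthogonal to the span of \<open>vs\<close>, by Gram-Schmidt. When \<open>v\<close> depends
  linearly on \<open>vs\<close>, the convention \<open>x / 0 = 0\<close> makes the step trivial, as it should be.\<close>

fun perp :: "'a::real_inner list \<Rightarrow> 'a \<Rightarrow> 'a" where
  "perp [] a = a"
| "perp (v # vs) a = perp vs a - (perp vs a \<bullet> perp vs v / (perp vs v \<bullet> perp vs v)) *\<^sub>R perp vs v"

lemma diff_perp_in_span: "a - perp vs a \<in> span (set vs)"
proof (induction vs arbitrary: a)
  case (Cons v vs)
  have sub: "x \<in> span (insert v (set vs))" if "x \<in> span (set vs)" for x
    using that span_mono[of "set vs" "insert v (set vs)"] by auto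
  have "v - (v - perp vs v) \<in> span (insert v (set vs))"
    by (rule span_diff[OF span_base sub[OF Cons[of v]]]) simp
  then have "perp vs v \<in> span (insert v (set vs))" by simp
  then have "(a - perp vs a) + (perp vs a \<bullet> perp vs v / (perp vs v \<bullet> perp vs v)) *\<^sub>R perp vs v \<in> span (insert v (set vs))"
    using sub[OF Cons[of a]] by (intro span_add span_scale) auto
  then show ?case by (simp add: algebra_simps)
qed (simp add: span_zero)

text \<open>By induction \<open>perp vs a\<close> is orthogonal to the span of \<open>vs\<close>, so
  its inner product with \<open>v\<close> equals that with \<open>perp vs v\<close>. The
  Gram-Schmidt step cancels precisely this; if \<open>perp vs v = 0\<close> there is nothing to
  cancel.\<close>

lemma perp_orthogonal_span:
  assumes "x \<in> span (set vs)"
  shows "perp vs a \<bullet> x = 0"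
proof -
  have gen: "perp vs a \<bullet> u = 0" if "u \<in> set vs" for u a
    using that
  proof (induction vs arbitrary: u a)
    case (Cons v vs)
    have span: "perp vs a \<bullet> x = 0" if "x \<in> span (set vs)" for a x
      using that by (induction rule: span_induct_alt) (auto simp: Cons.IH inner_add_right)
    have "perp vs a \<bullet> v = perp vs a \<bullet> perp vs v" for a
      using span[OF diff_perp_in_span[of v vs], of a] by (simp add: inner_diff_right)
    then show ?case
      using Cons.prems Cons.IH by (auto simp: inner_diff_left)
  qed simp
  from assms show ?thesis
    by (induction rule: span_induct_alt) (auto simp: inner_add_right gen)
qed

lemma perp_eq_0_iff: "perp vs a = 0 \<longleftrightarrow> a \<in> span (set vs)"
proof
  assume "a \<in> span (set vs)"
  then have "perp vs a \<bullet> a = 0" "perp vs a \<bullet> (a - perp vs a) = 0"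
    by (auto intro!: perp_orthogonal_span diff_perp_in_span)
  then show "perp vs a = 0" by (simp add: inner_diff_right)
qed (use diff_perp_in_span[of a vs] in auto)

lemma inner_perp_perp: "a \<bullet> perp vs a = perp vs a \<bullet> perp vs a"
  using perp_orthogonal_span[OF diff_perp_in_span[of a vs], of a] by (simp add: inner_diff_right inner_commute)

lemma perp_orthogonal_transformation:
  assumes "orthogonal_transformation f"
  shows "perp (map f vs) (f a) = f (perp vs a)"
proof (induction vs arbitrary: a)
  case (Cons v vs)
  have "linear f" "f x \<bullet> f y = x \<bullet> y" for x y
    using assms by (auto simp: orthogonal_transformation_def)
  then show ?case by (simp add: Cons linear_diff linear_scale)
qed simp

text \<open>This is the benefit of an explicit recursion: the component is a measurable function of
  all vectors jointly, with no separate treatment of linearly dependent configurations.\<close>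

lemma measurable_perp:
  fixes G :: "'b \<Rightarrow> 'a::euclidean_space"
  assumes "\<And>i. i \<in> set is \<Longrightarrow> F i \<in> borel_measurable M" "G \<in> borel_measurable M"
  shows "(\<lambda>x. perp (map (\<lambda>i. F i x) is) (G x)) \<in> borel_measurable M"
  using assms
proof (induction "is" arbitrary: G)
  case (Cons i "is")
  have [measurable]: "(\<lambda>x. perp (map (\<lambda>i. F i x) is) (G x)) \<in> borel_measurable M"
    "(\<lambda>x. perp (map (\<lambda>i. F i x) is) (F i x)) \<in> borel_measurable M"
    using Cons by auto
  show ?case by simp
qed simp

lemma borel_measurable_perp [measurable]: "perp vs \<in> borel_measurable (borel :: 'a::euclidean_space measure)"
proof (induction vs)
  case (Cons v vs)
  note [measurable] = Cons
  show ?case by simp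
qed simp

text \<open>Rotate so that the span of \<open>vs\<close> becomes a coordinate subspace. Then
  \<open>perp vs a\<close> consists of the remaining coordinates, which are independent standard
  normals; only their number matters. Inside the proof \<open>J\<close> indexes the span, and the
  set returned is its complement.\<close>

lemma nn_integral_perp:
  fixes vs :: "'a::euclidean_space list" and h :: "real \<Rightarrow> ennreal"
  assumes [measurable]: "h \<in> borel_measurable borel"
  obtains J :: "'a set" where "finite J" "card J = DIM('a) - dim (span (set vs))"
    "(\<integral>\<^sup>+a. h (norm (perp vs a)) \<partial>std_gauss) = (\<integral>\<^sup>+f. h (sqrt (\<Sum>i\<in>J. (f i)\<^sup>2)) \<partial>PiM J (\<lambda>_. std_normal))"
proof -
  define V where "V = span (set vs)"
  obtain B where B: "B \<subseteq> V" "pairwise orthogonal B" "\<And>x. x \<in> B \<Longrightarrow> norm x = 1" "card B = dim V" "span B = V"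
    using orthonormal_basis_subspace[of V] by (metis V_def subspace_span)
  obtain \<sigma> J where \<sigma>: "orthonormal_family \<sigma>" and J: "J \<subseteq> Basis" "bij_betw \<sigma> J B"
    using orthonormal_family_exists[OF B(2,3)] by metis
  define R where "R x = (\<Sum>b\<in>Basis. (x \<bullet> \<sigma> b) *\<^sub>R b)" for x :: 'a
  have R: "orthogonal_transformation R"
    unfolding R_def by (rule orthonormal_family_orthogonal_transformation[OF \<sigma>])
  have [measurable]: "R \<in> borel_measurable borel" by (rule orthogonal_transformation_borel_measurable[OF R])
  have Rb: "R x \<bullet> b = x \<bullet> \<sigma> b" if "b \<in> Basis" for x b using that by (simp add: R_def)
  have fin: "finite J" using J(1) finite_subset finite_Basis by blast
  have \<sigma>V: "\<sigma> b \<in> V" if "b \<in> J" for b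
    using that J(2) B(1) by (auto simp: bij_betw_def)
  have \<sigma>V': "x \<bullet> \<sigma> b = 0" if "x \<in> V" "b \<in> Basis - J" for x b
  proof -
    have orth: "\<sigma> b \<bullet> y = 0" if "y \<in> B" for y
    proof -
      obtain c where "c \<in> J" "y = \<sigma> c" using J(2) \<open>y \<in> B\<close> by (auto simp: bij_betw_def)
      then show ?thesis using \<sigma> J(1) \<open>b \<in> Basis - J\<close> unfolding orthonormal_family_def by auto
    qed
    have "x \<in> span B" using that B(5) by simp
    then have "\<sigma> b \<bullet> x = 0"
      by (induction rule: span_induct_alt) (auto simp: inner_add_right orth)
    then show ?thesis by (simp add: inner_commute)
  qed
  have norm_perp: "norm (perp vs a) = sqrt (\<Sum>b\<in>Basis - J. (R a \<bullet> b)\<^sup>2)" for a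
  proof -
    have "perp vs a \<bullet> perp vs a = (\<Sum>b\<in>Basis. (perp vs a \<bullet> \<sigma> b)\<^sup>2)"
      using orthonormal_family_inner[OF \<sigma>, of "perp vs a" "perp vs a"] by (simp add: power2_eq_square)
    also have "\<dots> = (\<Sum>b\<in>Basis - J. (perp vs a \<bullet> \<sigma> b)\<^sup>2)"
      using J(1) \<sigma>V by (intro sum.mono_neutral_right) (auto simp: V_def perp_orthogonal_span)
    also have "\<dots> = (\<Sum>b\<in>Basis - J. (R a \<bullet> b)\<^sup>2)"
    proof (intro sum.cong refl)
      fix b assume b: "b \<in> Basis - J"
      have "(a - perp vs a) \<bullet> \<sigma> b = 0" by (rule \<sigma>V'[OF _ b]) (simp add: V_def diff_perp_in_span)
      then show "(perp vs a \<bullet> \<sigma> b)\<^sup>2 = (R a \<bullet> b)\<^sup>2" using b by (simp add: Rb inner_diff_left)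
    qed
    finally show ?thesis by (simp add: norm_eq_sqrt_inner)
  qed
  interpret N: prob_space std_normal by (rule prob_space_std_normal)
  interpret P: product_sigma_finite "\<lambda>_::'a. std_normal" by standard
  interpret PJ: prob_space "PiM J (\<lambda>_. std_normal)"
    by (intro prob_space_PiM prob_space_std_normal)
  have "(\<integral>\<^sup>+a. h (norm (perp vs a)) \<partial>std_gauss) = (\<integral>\<^sup>+a. h (sqrt (\<Sum>b\<in>Basis - J. (a \<bullet> b)\<^sup>2)) \<partial>distr std_gauss borel R)"
    by (simp add: norm_perp nn_integral_distr)
  also have "\<dots> = (\<integral>\<^sup>+f. h (sqrt (\<Sum>b\<in>Basis - J. (f b)\<^sup>2)) \<partial>PiM Basis (\<lambda>_. std_normal))"
    unfolding distr_std_gauss_orthogonal_transformation[OF R]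
    by (subst std_gauss_eq_distr_PiM) (auto simp: nn_integral_distr intro!: nn_integral_cong)
  also have "\<dots> = (\<integral>\<^sup>+f. h (sqrt (\<Sum>b\<in>Basis - J. (f b)\<^sup>2)) \<partial>PiM (J \<union> (Basis - J)) (\<lambda>_. std_normal))"
    using J(1) by (simp add: Un_absorb1)
  \<comment> \<open>The integrand ignores the coordinates in \<open>J\<close>, whose product law has
    mass one.\<close>
  also have "\<dots> = (\<integral>\<^sup>+g. \<integral>\<^sup>+f. h (sqrt (\<Sum>b\<in>Basis - J. (merge J (Basis - J) (g, f) b)\<^sup>2)) \<partial>PiM (Basis - J) (\<lambda>_. std_normal) \<partial>PiM J (\<lambda>_. std_normal))"
    by (rule P.product_nn_integral_fold) (use fin in auto)
  also have "\<dots> = (\<integral>\<^sup>+f. h (sqrt (\<Sum>b\<in>Basis - J. (f b)\<^sup>2)) \<partial>PiM (Basis - J) (\<lambda>_. std_normal))"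
    using PJ.emeasure_space_1 by simp
  finally have "(\<integral>\<^sup>+a. h (norm (perp vs a)) \<partial>std_gauss) = (\<integral>\<^sup>+f. h (sqrt (\<Sum>b\<in>Basis - J. (f b)\<^sup>2)) \<partial>PiM (Basis - J) (\<lambda>_. std_normal))" .
  moreover have "card (Basis - J) = DIM('a) - dim (span (set vs))"
    using J B(4) fin by (simp add: card_Diff_subset bij_betw_same_card V_def)
  ultimately show ?thesis using that[of "Basis - J"] by simp
qed

section \<open>Polar coordinates\<close>

text \<open>The image of Lebesgue measure under the norm is determined by the volumes of balls, and
  the weight is the derivative of \<open>t \<mapsto> unit_ball_vol k * t ^ k\<close>. An arbitrary
  finite index set covers both the Gaussian coordinates left after projection and the coordinates of
  the solution.\<close>

lemma nn_integral_lborel_radial: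
  fixes I :: "'i set" and h :: "real \<Rightarrow> ennreal"
  assumes I: "finite I" "I \<noteq> {}" and [measurable]: "h \<in> borel_measurable borel"
  shows "(\<integral>\<^sup>+f. h (sqrt (\<Sum>i\<in>I. (f i)\<^sup>2)) \<partial>PiM I (\<lambda>_. lborel)) =
    (\<integral>\<^sup>+t. ennreal (unit_ball_vol (card I) * card I * t ^ (card I - 1)) * indicator {0..} t * h t \<partial>lborel)"
proof -
  let ?v = "unit_ball_vol (card I)" and ?k = "card I"
  have k: "?k > 0" using I by (simp add: card_gt_0_iff)
  have v: "?v > 0" by (rule unit_ball_vol_pos) simp
  interpret product_sigma_finite "\<lambda>_. lborel :: real measure" by standard
  define \<rho> where "\<rho> f = sqrt (\<Sum>i\<in>I. (f i)\<^sup>2)" for f :: "'i \<Rightarrow> real"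
  have [measurable]: "\<rho> \<in> borel_measurable (PiM I (\<lambda>_. lborel))"
    unfolding \<rho>_def using I by measurable
  define p where "p t = ennreal (?v * ?k * t ^ (?k - 1)) * indicator {0..} t" for t
  have [measurable]: "p \<in> borel_measurable borel" unfolding p_def by measurable
  have eq: "emeasure (distr (PiM I (\<lambda>_. lborel)) borel \<rho>) {..r} = emeasure (density lborel p) {..r}"
    and fin: "emeasure (density lborel p) {..r} < \<top>" for r
  proof -
    have L: "emeasure (distr (PiM I (\<lambda>_. lborel)) borel \<rho>) {..r} = emeasure (PiM I (\<lambda>_. lborel)) ({f. \<rho> f \<le> r} \<inter> space (PiM I (\<lambda>_. lborel)))"
      by (subst emeasure_distr) (auto intro!: arg_cong[where f = "emeasure _"])
    have R: "emeasure (density lborel p) {..r} = (\<integral>\<^sup>+t. p t * indicator {..r} t \<partial>lborel)"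
      by (simp add: emeasure_density)
    have Rp: "(\<integral>\<^sup>+t. p t * indicator {..r} t \<partial>lborel) = ennreal (?v * r ^ ?k)" if "r \<ge> 0" for r
    proof -
      have "(\<integral>\<^sup>+t. p t * indicator {..r} t \<partial>lborel) = (\<integral>\<^sup>+t. ennreal (?v * ?k * t ^ (?k - 1)) * indicator {0..r} t \<partial>lborel)"
        by (intro nn_integral_cong) (auto simp: p_def indicator_def)
      also have "\<dots> = ennreal (?v * r ^ ?k - ?v * 0 ^ ?k)"
        using v by (intro nn_integral_FTC_Icc[where F = "\<lambda>t. ?v * t ^ ?k"] that)
          (auto intro!: derivative_eq_intros)
      finally show ?thesis using k by (simp add: power_0_left)
    qed
    have Rn: "(\<integral>\<^sup>+t. p t * indicator {..r} t \<partial>lborel) = 0" if "r < 0" for r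
      using that by (subst nn_integral_0_iff_AE) (auto simp: p_def indicator_def intro!: AE_I2)
    have pos: "emeasure (distr (PiM I (\<lambda>_. lborel)) borel \<rho>) {..r} = ennreal (?v * r ^ ?k)" if "r > 0" for r
      using emeasure_cball_aux[OF I(1) that]
      by (subst emeasure_distr) (auto simp: \<rho>_def vimage_def intro!: arg_cong[where f = "emeasure _"])
    have neg: "emeasure (distr (PiM I (\<lambda>_. lborel)) borel \<rho>) {..r} = 0" if "r < 0" for r
    proof -
      have "\<rho> f \<ge> 0" for f by (simp add: \<rho>_def sum_nonneg)
      then have "\<rho> -` {..r} = {}" using that by (force simp: not_le dest: order_trans)
      then show ?thesis by (subst emeasure_distr) auto
    qed
    \<comment> \<open>The volume formula used for \<open>pos\<close> requires a positive radius;
      radius zero is reached as the limit of \<open>1 / (n + 1)\<close>.\<close>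
    have zero: "emeasure (distr (PiM I (\<lambda>_. lborel)) borel \<rho>) {..0} = 0"
    proof -
      have "(\<lambda>n. ennreal (?v * (1 / real (Suc n)) ^ ?k)) \<longlonglongrightarrow> ennreal (?v * 0 ^ ?k)"
        by (intro tendsto_intros LIMSEQ_Suc[OF lim_1_over_n])
      moreover have "emeasure (distr (PiM I (\<lambda>_. lborel)) borel \<rho>) {..0} \<le> ennreal (?v * (1 / real (Suc n)) ^ ?k)" for n
      proof -
        have "emeasure (distr (PiM I (\<lambda>_. lborel)) borel \<rho>) {..0} \<le> emeasure (distr (PiM I (\<lambda>_. lborel)) borel \<rho>) {..1 / real (Suc n)}"
          by (rule emeasure_mono) auto
        also have "\<dots> = ennreal (?v * (1 / real (Suc n)) ^ ?k)" by (rule pos) simp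
        finally show ?thesis .
      qed
      ultimately show ?thesis
        using k LIMSEQ_le_const by (fastforce simp: power_0_left)
    qed
    show "emeasure (distr (PiM I (\<lambda>_. lborel)) borel \<rho>) {..r} = emeasure (density lborel p) {..r}"
      using Rp[of r] Rn[of r] pos[of r] neg[of r] zero k unfolding R
      by (cases "r < 0"; cases "r = 0") (auto simp: power_0_left)
    show "emeasure (density lborel p) {..r} < \<top>"
      using Rp[of r] Rn[of r] unfolding R by (cases "r < 0") auto
  qed
  have "distr (PiM I (\<lambda>_. lborel)) borel \<rho> = density lborel p"
  proof (rule measure_eqI_generator_eq[where \<Omega> = UNIV and E = "range atMost" and A = "\<lambda>n::nat. {..real n}"])
    show "Int_stable (range (atMost :: real \<Rightarrow> _))" by (auto simp: Int_stable_def)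
    show "(\<Union>n::nat. {..real n}) = UNIV" using real_arch_simple by auto
    show "emeasure (distr (PiM I (\<lambda>_. lborel)) borel \<rho>) {..real n} \<noteq> \<infinity>" for n :: nat
      using eq[of "real n"] fin[of "real n"] by simp
    show "sets (distr (PiM I (\<lambda>_. lborel)) borel \<rho>) = sigma_sets UNIV (range atMost)"
      "sets (density lborel p) = sigma_sets UNIV (range atMost)"
      by (simp_all add: borel_eq_atMost)
  qed (auto simp: eq)
  then have "(\<integral>\<^sup>+t. h t \<partial>distr (PiM I (\<lambda>_. lborel)) borel \<rho>) = (\<integral>\<^sup>+t. h t \<partial>density lborel p)"
    by simp
  then show ?thesis
    by (simp add: nn_integral_distr nn_integral_density) (simp add: \<rho>_def p_def)
qed

section \<open>The law of the norm: chi variables and their reciprocals\<close>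

text \<open>Both sides integrate \<open>h\<close> against a measure that lives on the positive reals and gives
  \<open>{a..}\<close> the mass \<open>r / a\<close>.\<close>

lemma nn_integral_reciprocal_substitution:
  fixes h :: "real \<Rightarrow> ennreal"
  assumes r: "r > 0" and [measurable]: "h \<in> borel_measurable borel"
  shows "(\<integral>\<^sup>+t. indicator {0<..} t * h (r / t) \<partial>lborel) =
    (\<integral>\<^sup>+s. ennreal (r / s\<^sup>2) * indicator {0<..} s * h s \<partial>lborel)"
proof -
  define \<mu> where "\<mu> = distr (density lborel (indicator {0<..})) borel (\<lambda>t. r / t)"
  define \<nu> where "\<nu> = density lborel (\<lambda>s. ennreal (r / s\<^sup>2) * indicator {0<..} s)"
  have \<mu>a: "emeasure \<mu> {a..} = ennreal (r / a)" if "a > 0" for a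
  proof -
    have "emeasure \<mu> {a..} = (\<integral>\<^sup>+t. indicator {0<..} t * indicator {a..} (r / t) \<partial>lborel)"
      by (simp add: \<mu>_def nn_integral_indicator[symmetric] nn_integral_distr nn_integral_density
          del: nn_integral_indicator)
    also have "\<dots> = (\<integral>\<^sup>+t. indicator {0<..r / a} t \<partial>lborel)"
      using r that by (intro nn_integral_cong) (auto simp: indicator_def field_simps)
    finally show ?thesis using r that by simp
  qed
  have \<nu>a: "emeasure \<nu> {a..} = ennreal (r / a)" if "a > 0" for a
  proof -
    have "emeasure \<nu> {a..} = (\<integral>\<^sup>+s. ennreal (r / s\<^sup>2) * indicator {a..} s \<partial>lborel)"
      unfolding \<nu>_def using that
      by (subst emeasure_density) (auto intro!: nn_integral_cong simp: indicator_def)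
    also have "\<dots> = ennreal (- 0 - (- (r / a)))"
    proof (rule nn_integral_FTC_atLeast)
      show "((\<lambda>s. - (r / s)) \<longlongrightarrow> - 0) at_top"
        by (intro tendsto_minus real_tendsto_divide_at_top[OF tendsto_const filterlim_ident])
    qed (use that r in \<open>auto intro!: derivative_eq_intros simp: power2_eq_square\<close>)
    finally show ?thesis by simp
  qed
  have \<mu>0: "emeasure \<mu> (X - {0<..}) = 0" if [measurable]: "X \<in> sets borel" for X
  proof -
    have "emeasure \<mu> (X - {0<..}) = (\<integral>\<^sup>+t. indicator {0<..} t * indicator (X - {0<..}) (r / t) \<partial>lborel)"
      by (simp add: \<mu>_def nn_integral_indicator[symmetric] nn_integral_distr nn_integral_density
          del: nn_integral_indicator)
    also have "\<dots> = (\<integral>\<^sup>+(t::real). 0 \<partial>lborel)"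
      using r by (intro nn_integral_cong) (auto simp: indicator_def)
    finally show ?thesis by simp
  qed
  have \<nu>0: "emeasure \<nu> (X - {0<..}) = 0" if [measurable]: "X \<in> sets borel" for X
  proof -
    have "emeasure \<nu> (X - {0<..}) = (\<integral>\<^sup>+(t::real). 0 \<partial>lborel)"
      unfolding \<nu>_def
      by (subst emeasure_density; (simp; fail)?; intro nn_integral_cong) (auto simp: indicator_def)
    then show ?thesis by simp
  qed
  \<comment> \<open>Half-lines starting at or below 0 have infinite mass, so they cannot form an
    exhausting sequence. The generator therefore keeps only half-lines with positive endpoint and
    adds all Borel subsets of the nonpositive axis, which are null for both measures; the family
    stays closed under intersection.\<close>
  define E :: "real set set" where "E = {X \<in> sets borel. X \<subseteq> {..0::real}} \<union> atLeast ` {0<..}"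
  have E_borel: "E \<subseteq> sets borel" by (auto simp: E_def)
  have "range (atLeast :: real \<Rightarrow> _) \<subseteq> sigma_sets UNIV E"
  proof (rule image_subsetI)
    fix a :: real
    show "{a..} \<in> sigma_sets UNIV E"
    proof (cases "a > 0")
      case False
      have "(\<Union>n. {1 / real (Suc n)..}) \<in> sigma_sets UNIV E"
        by (intro sigma_sets.Union sigma_sets.Basic) (auto simp: E_def)
      also have "(\<Union>n. {1 / real (Suc n)..}) = {0::real<..}"
      proof (intro equalityI subsetI)
        fix x :: real assume "x \<in> (\<Union>n. {1 / real (Suc n)..})"
        then obtain n where "1 / real (Suc n) \<le> x" by auto
        moreover have "0 < 1 / real (Suc n)" by simp
        ultimately show "x \<in> {0<..}" by (metis greaterThan_iff less_le_trans)
      next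
        fix x :: real assume "x \<in> {0<..}"
        then obtain n where "inverse (real (Suc n)) < x" using reals_Archimedean[of x] by auto
        then have "x \<in> {1 / real (Suc n)..}" by (simp only: atLeast_iff inverse_eq_divide less_imp_le)
        then show "x \<in> (\<Union>n. {1 / real (Suc n)..})" by blast
      qed
      finally have "{a..0} \<union> {0::real<..} \<in> sigma_sets UNIV E"
        by (intro sigma_sets_Un sigma_sets.Basic[of "{a..0}"]) (auto simp: E_def)
      also have "{a..0} \<union> {0::real<..} = {a..}" using False by auto
      finally show ?thesis .
    qed (auto simp: E_def)
  qed
  then have sets_E: "sets borel = sigma_sets UNIV E"
    using E_borel sets.sigma_sets_subset[of E borel] sigma_sets_mono[of "range (atLeast :: real \<Rightarrow> _)" UNIV E]
    by (auto simp: borel_Ici)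
  have "\<mu> = \<nu>"
  proof (rule measure_eqI_generator_eq[where \<Omega> = UNIV and E = E and
        A = "case_nat {..0} (\<lambda>n. {1 / real (Suc n)..})"])
    show "Int_stable E"
    proof (rule Int_stableI)
      fix X Y assume X: "X \<in> E" and Y: "Y \<in> E"
      show "X \<inter> Y \<in> E"
      proof (cases "X \<subseteq> {..0} \<or> Y \<subseteq> {..0}")
        case True
        then show ?thesis using X Y E_borel unfolding E_def by blast
      next
        case False
        then obtain x y where "X = {x..}" "x > 0" "Y = {y..}" "y > 0"
          using X Y unfolding E_def by blast
        then have "X \<inter> Y = {max x y..}" "max x y > 0" by auto
        then show ?thesis unfolding E_def by blast
      qed
    qed
    show "emeasure \<mu> X = emeasure \<nu> X" if "X \<in> E" for X
    proof (cases "X \<subseteq> {..0}")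
      case True
      then have "X - {0<..} = X" by auto
      then show ?thesis using \<mu>0[of X] \<nu>0[of X] that E_borel by auto
    next
      case False
      then have "X \<in> atLeast ` {0<..}" using that by (simp add: E_def)
      then obtain x where "X = {x..}" "x > 0" by auto
      then show ?thesis by (simp only: \<mu>a \<nu>a)
    qed
    show "range (case_nat {..0} (\<lambda>n. {1 / real (Suc n)..})) \<subseteq> E"
      by (auto simp: E_def split: nat.splits)
    show "(\<Union>i. case_nat {..0} (\<lambda>n. {1 / real (Suc n)..}) i) = (UNIV :: real set)"
    proof (intro equalityI subsetI)
      fix x :: real
      show "x \<in> (\<Union>i. case_nat {..0} (\<lambda>n. {1 / real (Suc n)..}) i)"
      proof (cases "x > 0")
        case True
        then obtain n where "inverse (real (Suc n)) < x" using reals_Archimedean[of x] by auto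
        then have "x \<in> {1 / real (Suc n)..}" by (simp only: atLeast_iff inverse_eq_divide less_imp_le)
        then show ?thesis by (intro UN_I[of "Suc n"]) auto
      next
        case False
        then show ?thesis by (intro UN_I[of 0]) auto
      qed
    qed simp
    show "emeasure \<mu> (case_nat {..0} (\<lambda>n. {1 / real (Suc n)..}) i) \<noteq> \<infinity>" for i
    proof (cases i)
      case 0
      have "{..0} - {0<..} = {..0::real}" by auto
      then show ?thesis using \<mu>0[of "{..0}"] 0 by simp
    next
      case (Suc n)
      then show ?thesis using \<mu>a[of "1 / real (Suc n)"] by simp
    qed
  qed (auto simp: sets_E[symmetric] \<mu>_def \<nu>_def)
  then have "(\<integral>\<^sup>+s. h s \<partial>\<mu>) = (\<integral>\<^sup>+s. h s \<partial>\<nu>)" by simp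
  then show ?thesis
    by (simp add: \<mu>_def \<nu>_def nn_integral_distr nn_integral_density)
qed

text \<open>Sphere area at radius \<open>t\<close> times the Gaussian density there. For
  \<open>t > 0\<close> and \<open>k > 0\<close> this is the usual chi density, with the Gamma
  function hidden in the ball volume.\<close>

definition chi_density :: "nat \<Rightarrow> real \<Rightarrow> real" where
  "chi_density k t = unit_ball_vol k * k * t ^ (k - 1) * ((1 / sqrt (2 * pi)) ^ k * exp (- t\<^sup>2 / 2))"

lemma borel_measurable_chi_density [measurable]: "chi_density k \<in> borel_measurable borel"
  unfolding chi_density_def by measurable

text \<open>The joint normal density is a function of the norm, so it can be absorbed into the
  radial integrand. Leaving out \<open>t = 0\<close> costs nothing and prepares the substitution by
  the reciprocal.\<close>

lemma nn_integral_std_normal_radial: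
  fixes I :: "'i set" and h :: "real \<Rightarrow> ennreal"
  assumes I: "finite I" "I \<noteq> {}" and [measurable]: "h \<in> borel_measurable borel"
  shows "(\<integral>\<^sup>+f. h (sqrt (\<Sum>i\<in>I. (f i)\<^sup>2)) \<partial>PiM I (\<lambda>_. std_normal)) =
    (\<integral>\<^sup>+t. indicator {0<..} t * (ennreal (chi_density (card I) t) * h t) \<partial>lborel)"
proof -
  have meas: "(\<lambda>f. \<Prod>i\<in>I. ennreal (std_normal_density (f i))) \<in> borel_measurable (PiM I (\<lambda>_. lborel))"
    "(\<lambda>f. h (sqrt (\<Sum>i\<in>I. (f i)\<^sup>2))) \<in> borel_measurable (PiM I (\<lambda>_. lborel))"
    using I by measurable
  let ?g = "\<lambda>t. ennreal ((1 / sqrt (2 * pi)) ^ card I * exp (- t\<^sup>2 / 2))"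
  have "(\<integral>\<^sup>+f. h (sqrt (\<Sum>i\<in>I. (f i)\<^sup>2)) \<partial>PiM I (\<lambda>_. std_normal)) =
    (\<integral>\<^sup>+f. (\<Prod>i\<in>I. ennreal (std_normal_density (f i))) * h (sqrt (\<Sum>i\<in>I. (f i)\<^sup>2)) \<partial>PiM I (\<lambda>_. lborel))"
    unfolding PiM_std_normal[OF I(1)] by (rule nn_integral_density[OF meas])
  also have "\<dots> = (\<integral>\<^sup>+f. ?g (sqrt (\<Sum>i\<in>I. (f i)\<^sup>2)) * h (sqrt (\<Sum>i\<in>I. (f i)\<^sup>2)) \<partial>PiM I (\<lambda>_. lborel))"
    using prod_std_normal_density[OF I(1)] by (simp add: prod_ennreal sum_nonneg)
  also have "\<dots> = (\<integral>\<^sup>+t. ennreal (unit_ball_vol (card I) * card I * t ^ (card I - 1)) * indicator {0..} t * (?g t * h t) \<partial>lborel)"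
    by (rule nn_integral_lborel_radial[OF I, of "\<lambda>t. ?g t * h t"]) measurable
  also have "\<dots> = (\<integral>\<^sup>+t. indicator {0<..} t * (ennreal (chi_density (card I) t) * h t) \<partial>lborel)"
  proof (rule nn_integral_cong_AE)
    have "AE t in lborel. t \<noteq> (0::real)" by (rule AE_lborel_singleton)
    then show "AE t in lborel. ennreal (unit_ball_vol (card I) * card I * t ^ (card I - 1)) * indicator {0..} t * (?g t * h t) =
        indicator {0<..} t * (ennreal (chi_density (card I) t) * h t)"
    proof eventually_elim
      case (elim t)
      then show ?case
        by (cases "t > 0") (simp_all add: chi_density_def ennreal_mult mult.assoc)
    qed
  qed
  finally show ?thesis .
qed

lemma nn_integral_lborel_norm:
  fixes h :: "real \<Rightarrow> ennreal"
  assumes [measurable]: "h \<in> borel_measurable borel"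
  shows "(\<integral>\<^sup>+y. h (norm (y :: 'a::euclidean_space)) \<partial>lborel) =
    (\<integral>\<^sup>+t. ennreal (unit_ball_vol DIM('a) * DIM('a) * t ^ (DIM('a) - 1)) * indicator {0..} t * h t \<partial>lborel)"
proof -
  have "norm (\<Sum>b\<in>Basis. f b *\<^sub>R b :: 'a) = sqrt (\<Sum>b\<in>Basis. (f b)\<^sup>2)" for f
    by (subst euclidean_dist_l2[of _ 0, simplified dist_0_norm, unfolded dist_norm diff_0_right]) (simp add: L2_set_def)
  then have "(\<integral>\<^sup>+y. h (norm (y :: 'a)) \<partial>lborel) = (\<integral>\<^sup>+f. h (sqrt (\<Sum>b\<in>(Basis :: 'a set). (f b)\<^sup>2)) \<partial>PiM Basis (\<lambda>_. lborel))"
    by (subst lborel_eq) (simp add: nn_integral_distr)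
  also have "\<dots> = (\<integral>\<^sup>+t. ennreal (unit_ball_vol DIM('a) * DIM('a) * t ^ (DIM('a) - 1)) * indicator {0..} t * h t \<partial>lborel)"
    by (rule nn_integral_lborel_radial) auto
  finally show ?thesis .
qed

text \<open>This is the area of the unit sphere; the functional equation of Gamma absorbs the factor
  \<open>k / 2\<close>.\<close>

lemma unit_ball_vol_times_dim:
  assumes "k > 0"
  shows "unit_ball_vol (real k) * real k = 2 * pi powr (real k / 2) / Gamma (real k / 2)"
proof -
  have G: "Gamma (real k / 2 + 1) = real k / 2 * Gamma (real k / 2)"
    using assms by (intro Gamma_plus1) (auto simp: nonpos_Ints_def)
  have "Gamma (real k / 2) > 0" using assms by (intro Gamma_real_pos) simp
  then show ?thesis using assms unfolding unit_ball_vol_def G by (simp add: field_simps)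
qed

text \<open>Left: sphere area times claimed density, that is, the density of the norm. Right: the
  chi density pulled back along \<open>s \<mapsto> norm xt / s\<close>, with Jacobian
  \<open>norm xt / s\<^sup>2\<close>. The factors \<open>pi powr (- d / 2)\<close> and
  \<open>Gamma (d / 2)\<close> of the claim cancel the sphere area in dimension \<open>d\<close>;
  \<open>Gamma (n / 2)\<close> stems from the chi density.\<close>

lemma radial_min_norm_density:
  fixes xt :: "real ^ 'D" and y :: "real ^ 'd"
  assumes n: "n > 0" and s: "s > 0" and y: "norm y = s"
  shows "unit_ball_vol CARD('d) * CARD('d) * s ^ (CARD('d) - 1) * min_norm_density n xt y =
    norm xt / s\<^sup>2 * chi_density n (norm xt / s)"
proof -
  define r d where "r = norm xt" and "d = CARD('d)"
  have d: "d > 0" by (simp add: d_def)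
  have yy: "y \<bullet> y = s\<^sup>2" using y by (simp add: power2_norm_eq_inner[symmetric])
  have "(s\<^sup>2) powr a = s powr (2 * a)" for a
    using s by (simp add: powr_powr flip: powr_numeral)
  moreover have "2 * (- (real n + real d) / 2) = - (real n + real d)" by (simp add: field_simps)
  ultimately have "(s\<^sup>2) powr (- (real n + real d) / 2) = s powr (- (real n + real d))"
    by (simp only:)
  also have "\<dots> = 1 / (s ^ n * s ^ d)"
    using s by (simp add: powr_diff powr_minus powr_realpow divide_inverse)
  finally have s_powr: "(s\<^sup>2) powr (- (real n + real d) / 2) = 1 / (s ^ n * s ^ d)" .
  define gn gd where "gn = Gamma (real n / 2)" and "gd = Gamma (real d / 2)"
  have g: "gn > 0" "gd > 0" using n d by (auto simp: gn_def gd_def intro!: Gamma_real_pos)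
  have pin: "sqrt (2 * pi) ^ n = sqrt 2 ^ n * pi powr (real n / 2)"
    by (simp add: real_sqrt_mult power_mult_distrib powr_half_sqrt[symmetric] powr_realpow[symmetric] powr_powr)
  have sd: "s ^ d = s * s ^ (d - 1)" and rn: "r ^ n = r * r ^ (n - 1)" and sn: "s ^ n = s * s ^ (n - 1)"
    using d n by (simp_all flip: power_Suc)
  have e: "exp (- r\<^sup>2 / (2 * s\<^sup>2)) = exp (- (r / s)\<^sup>2 / 2)" by (simp add: power_divide)
  have "unit_ball_vol d * d * s ^ (d - 1) * min_norm_density n xt y =
    (2 * pi powr (real d / 2) / gd) * s ^ (d - 1) *
    (pi powr (- (real d / 2)) * (gd / gn) * (r / sqrt 2) ^ n *
     (1 / (s ^ n * s ^ d)) * exp (- (r / s)\<^sup>2 / 2))"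
    unfolding unit_ball_vol_times_dim[OF d] min_norm_density_def yy s_powr[unfolded d_def] d_def[symmetric] r_def[symmetric] e
      gd_def gn_def
    using s_powr by simp
  also have "\<dots> = 2 / gn * r ^ n / sqrt 2 ^ n / (s * s ^ n) * exp (- (r / s)\<^sup>2 / 2)"
    using s g by (simp add: powr_minus sd power_divide field_simps)
  also have "\<dots> = r / s\<^sup>2 * (2 * pi powr (real n / 2) / gn * (r / s) ^ (n - 1) *
      ((1 / sqrt (2 * pi)) ^ n * exp (- (r / s)\<^sup>2 / 2)))"
    using s g by (simp add: power_divide pin pin[unfolded mult.commute[of 2 pi]] rn sn power2_eq_square field_simps)
  also have "\<dots> = r / s\<^sup>2 * chi_density n (r / s)"
    unfolding chi_density_def unit_ball_vol_times_dim[OF n, symmetric] gn_def by simp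
  finally show ?thesis by (simp add: r_def d_def)
qed

lemma borel_measurable_min_norm_density [measurable]:
  "(min_norm_density n xt :: real ^ 'd \<Rightarrow> real) \<in> borel_measurable borel"
  unfolding min_norm_density_def by measurable

text \<open>Under the claimed density the norm is distributed as \<open>norm xt\<close> over a chi
  variable: polar coordinates, then the reciprocal substitution. Total mass one is not
  presupposed.\<close>

lemma nn_integral_min_norm_density:
  fixes xt :: "real ^ 'D" and h :: "real \<Rightarrow> ennreal"
  assumes n: "n > 0" and xt: "xt \<noteq> 0" and [measurable]: "h \<in> borel_measurable borel"
  shows "(\<integral>\<^sup>+y. h (norm y) \<partial>density lborel (min_norm_density n xt :: real ^ 'd \<Rightarrow> real)) =
    (\<integral>\<^sup>+t. indicator {0<..} t * (ennreal (chi_density n t) * h (norm xt / t)) \<partial>lborel)"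
proof -
  define e :: "real ^ 'd" where "e = axis (SOME i. True) 1"
  have e: "norm e = 1" by (simp add: e_def)
  define m where "m t = min_norm_density n xt (t *\<^sub>R e)" for t
  have m: "min_norm_density n xt y = m (norm y)" for y :: "real ^ 'd"
    by (simp add: m_def min_norm_density_def e power2_norm_eq_inner[symmetric])
  have [measurable]: "m \<in> borel_measurable borel" unfolding m_def by measurable
  have r: "norm xt > 0" using xt by simp
  have "(\<integral>\<^sup>+y. h (norm y) \<partial>density lborel (min_norm_density n xt :: real ^ 'd \<Rightarrow> real)) =
    (\<integral>\<^sup>+y. ennreal (m (norm y)) * h (norm (y :: real ^ 'd)) \<partial>lborel)"
    by (subst nn_integral_density) (auto simp: m)
  also have "\<dots> = (\<integral>\<^sup>+t. ennreal (unit_ball_vol CARD('d) * CARD('d) * t ^ (CARD('d) - 1)) * indicator {0..} t * (ennreal (m t) * h t) \<partial>lborel)"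
    by (subst nn_integral_lborel_norm[of "\<lambda>t. ennreal (m t) * h t"]) auto
  also have "\<dots> = (\<integral>\<^sup>+s. ennreal (norm xt / s\<^sup>2) * indicator {0<..} s * (ennreal (chi_density n (norm xt / s)) * h s) \<partial>lborel)"
  proof (rule nn_integral_cong_AE)
    have "AE t in lborel. t \<noteq> (0::real)" by (rule AE_lborel_singleton)
    then show "AE t in lborel. ennreal (unit_ball_vol CARD('d) * CARD('d) * t ^ (CARD('d) - 1)) * indicator {0..} t * (ennreal (m t) * h t) =
        ennreal (norm xt / t\<^sup>2) * indicator {0<..} t * (ennreal (chi_density n (norm xt / t)) * h t)"
    proof eventually_elim
      case (elim s)
      show ?case
      proof (cases "s > 0")
        case True
        have "unit_ball_vol CARD('d) * CARD('d) * s ^ (CARD('d) - 1) * m s = norm xt / s\<^sup>2 * chi_density n (norm xt / s)"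
          unfolding m_def using True e by (intro radial_min_norm_density n) auto
        then have "ennreal (unit_ball_vol CARD('d) * CARD('d) * s ^ (CARD('d) - 1)) * ennreal (m s) =
            ennreal (norm xt / s\<^sup>2) * ennreal (chi_density n (norm xt / s))"
          using True by (simp add: ennreal_mult'[symmetric])
        then show ?thesis using True by (simp add: mult.assoc[symmetric])
      qed (use elim in auto)
    qed
  qed
  also have "\<dots> = (\<integral>\<^sup>+t. indicator {0<..} t * (ennreal (chi_density n (norm xt / (norm xt / t))) * h (norm xt / t)) \<partial>lborel)"
    by (rule nn_integral_reciprocal_substitution[OF r, symmetric]) measurable
  also have "\<dots> = (\<integral>\<^sup>+t. indicator {0<..} t * (ennreal (chi_density n t) * h (norm xt / t)) \<partial>lborel)"
    using r by (intro nn_integral_cong) (auto simp: indicator_def)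
  finally show ?thesis .
qed

section \<open>Gaussian matrices\<close>

text \<open>This is left multiplication by an orthogonal matrix: each column is re-expressed in the
  family \<tau>, and the inner product of matrices is the sum of those of the columns.\<close>

lemma orthogonal_transformation_rows:
  assumes \<tau>: "orthonormal_family (\<tau> :: real ^ 'D \<Rightarrow> real ^ 'D)"
  shows "orthogonal_transformation (\<lambda>A :: real ^ 'd ^ 'D. \<chi> i. transpose A *v \<tau> (axis i 1))"
  unfolding orthogonal_transformation_def
proof (intro conjI allI)
  show "linear (\<lambda>A :: real ^ 'd ^ 'D. \<chi> i. transpose A *v \<tau> (axis i 1))"
    by (intro linearI) (simp_all add: vec_eq_iff transpose_def matrix_vector_mult_def
        algebra_simps sum.distrib sum_distrib_left)
  fix A B :: "real ^ 'd ^ 'D"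
  have col: "(transpose A *v x) $ j = column j A \<bullet> x" for A :: "real ^ 'd ^ 'D" and x j
    by (simp add: matrix_vector_mult_def transpose_def column_def inner_vec_def)
  have inner_col: "(transpose A *v x) \<bullet> (transpose B *v x) = (\<Sum>j\<in>UNIV. (column j A \<bullet> x) * (column j B \<bullet> x))" for x
    by (simp only: inner_vec_def[of "transpose A *v x"] col inner_real_def)
  have sum_Basis: "(\<Sum>i\<in>UNIV. g (axis i 1)) = (\<Sum>b\<in>(Basis :: (real ^ 'D) set). g b)" for g :: "real ^ 'D \<Rightarrow> real"
  proof -
    have "inj (\<lambda>i. axis i 1 :: real ^ 'D)" by (auto simp: inj_on_def axis_eq_axis)
    moreover have "range (\<lambda>i. axis i 1 :: real ^ 'D) = Basis" by (auto simp: Basis_vec_def)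
    ultimately show ?thesis by (metis (no_types, lifting) sum.reindex_cong)
  qed
  have "(\<chi> i. transpose A *v \<tau> (axis i 1)) \<bullet> (\<chi> i. transpose B *v \<tau> (axis i 1)) =
      (\<Sum>i\<in>UNIV. \<Sum>j\<in>UNIV. (column j A \<bullet> \<tau> (axis i 1)) * (column j B \<bullet> \<tau> (axis i 1)))"
    by (simp only: inner_vec_def[of "\<chi> i. transpose A *v \<tau> (axis i 1)"] vec_lambda_beta inner_col)
  also have "\<dots> = (\<Sum>j\<in>UNIV. \<Sum>i\<in>UNIV. (column j A \<bullet> \<tau> (axis i 1)) * (column j B \<bullet> \<tau> (axis i 1)))"
    by (rule sum.swap)
  also have "\<dots> = (\<Sum>j\<in>UNIV. column j A \<bullet> column j B)"
    by (simp only: sum_Basis[of "\<lambda>b. (column _ A \<bullet> \<tau> b) * (column _ B \<bullet> \<tau> b)"] orthonormal_family_inner[OF \<tau>])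
  also have "\<dots> = (\<Sum>j\<in>UNIV. \<Sum>i\<in>UNIV. A $ i $ j * B $ i $ j)"
    by (simp add: column_def inner_vec_def)
  also have "\<dots> = A \<bullet> B"
    by (subst sum.swap) (simp add: inner_vec_def)
  finally show "(\<chi> i. transpose A *v \<tau> (axis i 1)) \<bullet> (\<chi> i. transpose B *v \<tau> (axis i 1)) = A \<bullet> B" .
qed

text \<open>The counterpart on the right: it rotates the domain of the matrix, and is what transfers
  rotation invariance to the solution.\<close>

lemma orthogonal_transformation_map_rows:
  assumes R: "orthogonal_transformation R"
  shows "orthogonal_transformation (\<lambda>A :: ('a::real_inner) ^ 'D. \<chi> i. R (A $ i))"
proof -
  have "linear R" "\<And>x y. R x \<bullet> R y = x \<bullet> y" using R by (auto simp: orthogonal_transformation_def)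
  then show ?thesis
    unfolding orthogonal_transformation_def
    by (auto intro!: linearI simp: vec_eq_iff inner_vec_def linear_add linear_scale)
qed

definition replace_row :: "('a::real_inner) ^ 'D \<Rightarrow> 'D \<Rightarrow> 'a \<Rightarrow> 'a ^ 'D" where
  "replace_row A i b = (\<chi> k. if k = i then b else A $ k)"

text \<open>Exchanging the \<open>i\<close>-th row with an independent standard Gaussian vector is an orthogonal
  transformation of the pair, so it preserves the joint law.\<close>

lemma nn_integral_replace_row:
  fixes \<phi> :: "'a::euclidean_space ^ 'D \<Rightarrow> ennreal"
  assumes [measurable]: "\<phi> \<in> borel_measurable borel"
  shows "(\<integral>\<^sup>+A. \<phi> A \<partial>std_gauss) = (\<integral>\<^sup>+A. \<integral>\<^sup>+b. \<phi> (replace_row A i b) \<partial>std_gauss \<partial>std_gauss)"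
proof -
  define S where "S p = (replace_row (fst p) i (snd p), fst p $ i)" for p :: "('a ^ 'D) \<times> 'a"
  interpret G: prob_space "std_gauss :: 'a measure" by (rule prob_space_std_gauss)
  have S: "orthogonal_transformation S"
    unfolding orthogonal_transformation_def
  proof (intro conjI allI)
    show "linear S"
      by (intro linearI) (auto simp: S_def replace_row_def vec_eq_iff)
    fix p q :: "('a ^ 'D) \<times> 'a"
    show "S p \<bullet> S q = p \<bullet> q"
      by (simp add: S_def replace_row_def inner_vec_def inner_prod_def sum.remove[of UNIV i])
  qed
  have [measurable]: "S \<in> borel_measurable borel" by (rule orthogonal_transformation_borel_measurable[OF S])
  have [measurable]: "(\<lambda>p :: ('a ^ 'D) \<times> 'a. \<phi> (fst p)) \<in> borel_measurable borel"
    by (simp add: borel_prod[symmetric])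
  have "(\<integral>\<^sup>+A. \<phi> A \<partial>std_gauss) = (\<integral>\<^sup>+A. \<integral>\<^sup>+b. \<phi> (fst (A, b)) \<partial>(std_gauss :: 'a measure) \<partial>std_gauss)"
    using G.emeasure_space_1 by simp
  also have "\<dots> = (\<integral>\<^sup>+p. \<phi> (fst p) \<partial>(std_gauss \<Otimes>\<^sub>M (std_gauss :: 'a measure)))"
    by (rule G.nn_integral_fst) (simp add: std_gauss_pair)
  also have "\<dots> = (\<integral>\<^sup>+p. \<phi> (fst p) \<partial>distr (std_gauss :: (('a ^ 'D) \<times> 'a) measure) borel S)"
    by (simp add: std_gauss_pair distr_std_gauss_orthogonal_transformation[OF S])
  also have "\<dots> = (\<integral>\<^sup>+p. \<phi> (fst (S p)) \<partial>(std_gauss \<Otimes>\<^sub>M (std_gauss :: 'a measure)))"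
    by (simp add: nn_integral_distr std_gauss_pair)
  also have "\<dots> = (\<integral>\<^sup>+A. \<integral>\<^sup>+b. \<phi> (fst (S (A, b))) \<partial>std_gauss \<partial>std_gauss)"
    by (rule G.nn_integral_fst[symmetric]) (simp add: std_gauss_pair)
  finally show ?thesis by (simp add: S_def)
qed

definition row_perp :: "'D list \<Rightarrow> 'D \<Rightarrow> 'a::euclidean_space ^ 'D \<Rightarrow> 'a" where
  "row_perp is i A = perp (map (\<lambda>k. A $ k) is) (A $ i)"

lemma borel_measurable_vec_component [measurable]:
  "(\<lambda>x :: 'a::euclidean_space ^ 'D. x $ i) \<in> borel_measurable borel"
  by (intro borel_measurable_continuous_onI continuous_intros)

lemma borel_measurable_row_perp [measurable]: "row_perp is i \<in> borel_measurable borel"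
  unfolding row_perp_def by (rule measurable_perp) measurable

lemma row_perp_replace_row:
  "i \<notin> set is \<Longrightarrow> row_perp is i (replace_row A i b) = perp (map (\<lambda>k. A $ k) is) b"
  unfolding row_perp_def replace_row_def
  by (intro arg_cong2[where f = perp] map_cong) auto

text \<open>With the rows in \<open>is\<close> held fixed, row \<open>i\<close> is Gaussian, and a
  span of fewer than \<open>DIM('a)\<close> vectors is a Lebesgue null set.\<close>

lemma AE_row_perp_nonzero:
  assumes i: "i \<notin> set is" and len: "length is < DIM('a)"
  shows "AE A in (std_gauss :: ('a::euclidean_space ^ 'D) measure). row_perp is i A \<noteq> 0"
proof -
  have null: "(\<integral>\<^sup>+b. indicator {0} (perp vs b) \<partial>(std_gauss :: 'a measure)) = 0" if "length vs < DIM('a)" for vs :: "'a list"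
  proof -
    have "dim (span (set vs)) \<le> card (set vs)" by (simp add: dim_le_card')
    also have "\<dots> < DIM('a)" using that card_length[of vs] by simp
    finally have "negligible (span (set vs))" by (rule negligible_lowdim)
    moreover have "span (set vs) \<in> sets borel" by (simp add: borel_closed)
    ultimately have "span (set vs) \<in> null_sets lborel"
      by (simp add: negligible_iff_null_sets null_sets_completion_iff)
    then have "AE b in lborel. b \<notin> span (set vs)" by (rule AE_not_in)
    then have "AE b in (std_gauss :: 'a measure). b \<notin> span (set vs)" by (rule AE_std_gauss)
    then have "AE b in (std_gauss :: 'a measure). indicator {0} (perp vs b) = (0 :: ennreal)"
      by eventually_elim (simp add: perp_eq_0_iff)
    then show ?thesis
      by (subst nn_integral_0_iff_AE) auto
  qed
  have "(\<integral>\<^sup>+A. indicator {0} (row_perp is i A) \<partial>(std_gauss :: ('a ^ 'D) measure)) =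
    (\<integral>\<^sup>+A. \<integral>\<^sup>+b. indicator {0} (perp (map (\<lambda>k. A $ k) is) b) \<partial>std_gauss \<partial>(std_gauss :: ('a ^ 'D) measure))"
    using i by (subst nn_integral_replace_row[where i = i]) (auto simp: row_perp_replace_row)
  also have "\<dots> = 0" using len by (simp add: null)
  finally have "AE A in (std_gauss :: ('a ^ 'D) measure). indicator {0} (row_perp is i A) = (0 :: ennreal)"
    by (subst (asm) nn_integral_0_iff_AE) auto
  then show ?thesis by eventually_elim (auto simp: indicator_def split: if_splits)
qed

text \<open>Each new row almost surely avoids the span of those already listed, which are fewer than
  \<open>DIM('a)\<close>.\<close>

lemma AE_dim_rows:
  assumes "distinct is" and "length is \<le> DIM('a)"
  shows "AE A in (std_gauss :: ('a::euclidean_space ^ 'D) measure). dim (span (set (map (\<lambda>k. A $ k) is))) = length is"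
  using assms
proof (induction "is")
  case (Cons i "is")
  have "AE A in (std_gauss :: ('a ^ 'D) measure). row_perp is i A \<noteq> 0"
    using Cons.prems by (intro AE_row_perp_nonzero) auto
  moreover have "AE A in (std_gauss :: ('a ^ 'D) measure). dim (span (set (map (\<lambda>k. A $ k) is))) = length is"
    using Cons by auto
  ultimately show ?case
    by eventually_elim (simp add: row_perp_def perp_eq_0_iff dim_insert)
qed simp

text \<open>Given the rows in \<open>is\<close>, the law of the norm depends only on the dimension
  of their span. That dimension is almost surely constant, so averaging over these rows changes
  nothing.\<close>

lemma nn_integral_norm_row_perp:
  fixes h :: "real \<Rightarrow> ennreal"
  assumes i: "i \<notin> set is" "distinct is" and len: "length is < DIM('a)" and [measurable]: "h \<in> borel_measurable borel"
  shows "(\<integral>\<^sup>+A. h (norm (row_perp is i A)) \<partial>(std_gauss :: ('a::euclidean_space ^ 'D) measure)) =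
    (\<integral>\<^sup>+t. indicator {0<..} t * (ennreal (chi_density (DIM('a) - length is) t) * h t) \<partial>lborel)"
proof -
  let ?c = "\<integral>\<^sup>+t. indicator {0<..} t * (ennreal (chi_density (DIM('a) - length is) t) * h t) \<partial>lborel"
  interpret G: prob_space "std_gauss :: ('a ^ 'D) measure" by (rule prob_space_std_gauss)
  have chi: "(\<integral>\<^sup>+b. h (norm (perp vs b)) \<partial>(std_gauss :: 'a measure)) = ?c"
    if vs: "dim (span (set vs)) = length is" for vs :: "'a list"
  proof -
    obtain J :: "'a set" where J: "finite J" "card J = DIM('a) - dim (span (set vs))"
      "(\<integral>\<^sup>+a. h (norm (perp vs a)) \<partial>std_gauss) = (\<integral>\<^sup>+f. h (sqrt (\<Sum>i\<in>J. (f i)\<^sup>2)) \<partial>PiM J (\<lambda>_. std_normal))"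
      using nn_integral_perp[of h vs] by auto
    \<comment> \<open>Here the strict bound on \<open>length is\<close> is used: at least one
      coordinate must remain for polar coordinates.\<close>
    have "J \<noteq> {}" using J(2) vs len by (auto simp del: dim_span)
    then show ?thesis
      using nn_integral_std_normal_radial[OF J(1), of h] by (simp only: J(2,3) vs assms(4) simp_thms)
  qed
  have "(\<integral>\<^sup>+A. h (norm (row_perp is i A)) \<partial>(std_gauss :: ('a ^ 'D) measure)) =
    (\<integral>\<^sup>+A. \<integral>\<^sup>+b. h (norm (perp (map (\<lambda>k. A $ k) is) b)) \<partial>std_gauss \<partial>(std_gauss :: ('a ^ 'D) measure))"
    using i by (subst nn_integral_replace_row[where i = i]) (auto simp: row_perp_replace_row)
  also have "\<dots> = (\<integral>\<^sup>+A. ?c \<partial>(std_gauss :: ('a ^ 'D) measure))"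
  proof (rule nn_integral_cong_AE)
    have "AE A in (std_gauss :: ('a ^ 'D) measure). dim (span (set (map (\<lambda>k. A $ k) is))) = length is"
      using i len by (intro AE_dim_rows) auto
    then show "AE A in (std_gauss :: ('a ^ 'D) measure). (\<integral>\<^sup>+b. h (norm (perp (map (\<lambda>k. A $ k) is) b)) \<partial>(std_gauss :: 'a measure)) = ?c"
      by eventually_elim (rule chi)
  qed
  also have "\<dots> = ?c" using G.emeasure_space_1 by simp
  finally show ?thesis .
qed

section \<open>The solution of minimal norm\<close>

text \<open>The argument \<open>c\<close> stands for the junk value \<open>min_norm_element {}\<close>: the linear system is
  inconsistent exactly when the vector \<open>w\<close> below vanishes, which is a null event.\<close>

definition scaled_inverse :: "real \<Rightarrow> 'a::real_inner \<Rightarrow> 'a \<Rightarrow> 'a" where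
  "scaled_inverse r c w = (if w = 0 then c else (r / (w \<bullet> w)) *\<^sub>R w)"

text \<open>Every solution has inner product \<open>r\<close> with \<open>w\<close>, because
  \<open>a - w\<close> lies in the span of \<open>vs\<close>. So \<open>w = 0\<close> leaves no
  solution, and otherwise the multiple \<open>y0\<close> of \<open>w\<close> is a solution
  orthogonal to all differences \<open>y - y0\<close>; Pythagoras makes it the unique
  minimiser.\<close>

lemma min_norm_element_affine:
  fixes a :: "real ^ 'd"
  assumes r: "r \<noteq> 0"
  shows "min_norm_element {y. a \<bullet> y = r \<and> (\<forall>v\<in>set vs. v \<bullet> y = 0)} =
    scaled_inverse r (min_norm_element {}) (perp vs a)"
proof -
  define w where "w = perp vs a"
  define S where "S = {y. a \<bullet> y = r \<and> (\<forall>v\<in>set vs. v \<bullet> y = 0)}"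
  have wy: "w \<bullet> y = r" if "y \<in> S" for y
  proof -
    have "x \<bullet> y = 0" if "x \<in> span (set vs)" for x
      using that
      by (induction rule: span_induct_alt) (use \<open>y \<in> S\<close> in \<open>auto simp: inner_add_left S_def\<close>)
    from this[OF diff_perp_in_span[of a vs]] show ?thesis
      using that by (simp add: S_def w_def inner_diff_left)
  qed
  show ?thesis
  proof (cases "w = 0")
    case True
    then have "S = {}" using wy r by auto
    then show ?thesis using True by (simp add: S_def[symmetric] w_def[symmetric] scaled_inverse_def)
  next
    case False
    define y0 where "y0 = (r / (w \<bullet> w)) *\<^sub>R w"
    have "a \<bullet> w = w \<bullet> w" by (simp add: w_def inner_perp_perp)
    moreover have "v \<bullet> w = 0" if "v \<in> set vs" for v
      using perp_orthogonal_span[of v vs a] that by (simp add: w_def span_base inner_commute)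
    ultimately have y0: "y0 \<in> S" using False by (simp add: S_def y0_def)
    have pyth: "(norm y)\<^sup>2 = (norm y0)\<^sup>2 + (norm (y - y0))\<^sup>2" if "y \<in> S" for y
    proof -
      have "y0 \<bullet> (y - y0) = 0"
        using wy[OF that] wy[OF y0] by (simp add: y0_def inner_diff_right)
      then show ?thesis
        using norm_add_Pythagorean[of y0 "y - y0"] by (simp add: orthogonal_def)
    qed
    have "(SOME x. is_arg_min norm (\<lambda>x. x \<in> S) x) = y0"
    proof (rule some_equality)
      have "norm y0 \<le> norm y" if "y \<in> S" for y
      proof (rule power2_le_imp_le)
        show "(norm y0)\<^sup>2 \<le> (norm y)\<^sup>2" using pyth[OF that] zero_le_power2[of "norm (y - y0)"] by linarith
      qed simp
      then show "is_arg_min norm (\<lambda>x. x \<in> S) y0" using y0 by (auto simp: is_arg_min_def not_less)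
    next
      fix y assume y: "is_arg_min norm (\<lambda>x. x \<in> S) y"
      then have "y \<in> S" "norm y \<le> norm y0" using y0 by (auto simp: is_arg_min_def not_less)
      then have "(norm y)\<^sup>2 \<le> (norm y0)\<^sup>2" by (intro power_mono) auto
      then have "(norm (y - y0))\<^sup>2 \<le> 0" using pyth[OF \<open>y \<in> S\<close>] by simp
      then show "y = y0" by simp
    qed
    then show ?thesis
      using False by (simp add: min_norm_element_def arg_min_on_def arg_min_def S_def[symmetric] w_def[symmetric] y0_def scaled_inverse_def)
  qed
qed

text \<open>Only the law of the norm is computed: almost surely it is \<open>norm xt\<close> over
  the length of \<open>row_perp\<close>, a chi variable. The vector \<open>c\<close> is taken only
  on a null event.\<close>

lemma distr_scaled_inverse_row_perp:
  fixes xt :: "real ^ 'E" and c :: "real ^ 'd"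
  assumes i: "i \<notin> set is" "distinct is" and len: "length is < CARD('d)" and xt: "xt \<noteq> 0"
  shows "distr (std_gauss :: (real ^ 'd ^ 'D) measure) borel (\<lambda>A. scaled_inverse (norm xt) c (row_perp is i A)) =
    density lborel (\<lambda>y. ennreal (min_norm_density (CARD('d) - length is) xt y))"
proof -
  define r n where "r = norm xt" and "n = CARD('d) - length is"
  have r: "r > 0" and n: "n > 0" using xt len by (auto simp: r_def n_def)
  define Y where "Y A = scaled_inverse r c (row_perp is i A)" for A :: "real ^ 'd ^ 'D"
  have [measurable]: "(\<lambda>w. scaled_inverse r c w) \<in> borel_measurable borel"
    unfolding scaled_inverse_def by measurable
  have [measurable]: "Y \<in> borel_measurable borel" unfolding Y_def by measurable
  interpret G: prob_space "std_gauss :: (real ^ 'd ^ 'D) measure" by (rule prob_space_std_gauss)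
  define \<mu> where "\<mu> = distr (std_gauss :: (real ^ 'd ^ 'D) measure) borel Y"
  define \<nu> where "\<nu> = density lborel (\<lambda>y :: real ^ 'd. ennreal (min_norm_density n xt y))"
  have [measurable_cong, simp]: "sets \<mu> = sets borel" "sets \<nu> = sets borel" by (simp_all add: \<mu>_def \<nu>_def)
  have [simp]: "space \<nu> = UNIV" by (simp add: \<nu>_def)
  interpret \<mu>: prob_space \<mu> unfolding \<mu>_def by (rule G.prob_space_distr) measurable
  have nonzero: "AE A in (std_gauss :: (real ^ 'd ^ 'D) measure). row_perp is i A \<noteq> 0"
    using i len by (intro AE_row_perp_nonzero) auto
  have norm_eq: "distr \<mu> borel norm = distr \<nu> borel norm"
  proof (rule measure_eqI)
    fix X assume "X \<in> sets (distr \<mu> borel norm)"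
    then have [measurable]: "X \<in> sets borel" by simp
    have "emeasure (distr \<mu> borel norm) X = (\<integral>\<^sup>+y. indicator X (norm y) \<partial>\<mu>)"
      by (simp add: nn_integral_distr nn_integral_indicator[symmetric] del: nn_integral_indicator)
    also have "\<dots> = (\<integral>\<^sup>+A. indicator X (norm (Y A)) \<partial>std_gauss)"
      by (simp add: \<mu>_def nn_integral_distr)
    also have "\<dots> = (\<integral>\<^sup>+A. indicator X (r / norm (row_perp is i A)) \<partial>(std_gauss :: (real ^ 'd ^ 'D) measure))"
    proof (rule nn_integral_cong_AE)
      show "AE A in std_gauss. indicator X (norm (Y A)) = indicator X (r / norm (row_perp is i A))"
        using nonzero
      proof eventually_elim
        case (elim A)
        have "norm (Y A) = r / (norm (row_perp is i A))\<^sup>2 * norm (row_perp is i A)"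
          using elim r by (simp add: Y_def scaled_inverse_def power2_norm_eq_inner)
        then have "norm (Y A) = r / norm (row_perp is i A)"
          using elim by (simp add: power2_eq_square)
        then show ?case by simp
      qed
    qed
    also have "\<dots> = (\<integral>\<^sup>+t. indicator {0<..} t * (ennreal (chi_density n t) * indicator X (r / t)) \<partial>lborel)"
      using nn_integral_norm_row_perp[OF i, where h = "\<lambda>t. indicator X (r / t)" and 'a = "real ^ 'd"] len
      by (simp add: n_def)
    also have "\<dots> = (\<integral>\<^sup>+y. indicator X (norm y) \<partial>\<nu>)"
      unfolding \<nu>_def r_def by (rule nn_integral_min_norm_density[OF n xt, symmetric]) measurable
    also have "\<dots> = emeasure (distr \<nu> borel norm) X"
      by (simp add: nn_integral_distr nn_integral_indicator[symmetric] del: nn_integral_indicator)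
    finally show "emeasure (distr \<mu> borel norm) X = emeasure (distr \<nu> borel norm) X" .
  qed simp
  \<comment> \<open>The claimed density need not be integrated: its mass equals that of its norm
    law, which is also the norm law of the probability measure \<mu>.\<close>
  have "emeasure \<nu> UNIV = emeasure (distr \<nu> borel norm) UNIV" by (subst emeasure_distr) auto
  also have "\<dots> = emeasure (distr \<mu> borel norm) UNIV" by (simp only: norm_eq)
  also have "\<dots> = emeasure \<mu> (space \<mu>)" by (subst emeasure_distr) auto
  finally have fin: "finite_measure \<nu>"
    by (intro finite_measureI) (simp add: \<mu>.emeasure_space_1)
  have inv_\<mu>: "distr \<mu> borel R = \<mu>" if R: "orthogonal_transformation R" for R
  proof -
    define \<rho> where "\<rho> A = (\<chi> k. R (A $ k))" for A :: "real ^ 'd ^ 'D"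
    have \<rho>: "orthogonal_transformation \<rho>"
      unfolding \<rho>_def by (rule orthogonal_transformation_map_rows[OF R])
    have [measurable]: "R \<in> borel_measurable borel" "\<rho> \<in> borel_measurable borel"
      by (rule orthogonal_transformation_borel_measurable[OF R], rule orthogonal_transformation_borel_measurable[OF \<rho>])
    have "linear R" "\<And>x y. R x \<bullet> R y = x \<bullet> y" using R by (auto simp: orthogonal_transformation_def)
    have perp: "row_perp is i (\<rho> A) = R (row_perp is i A)" for A
      using perp_orthogonal_transformation[OF R, of "map (\<lambda>k. A $ k) is" "A $ i"]
      by (simp add: row_perp_def \<rho>_def o_def)
    have "distr \<mu> borel R = distr std_gauss borel (\<lambda>A. R (Y A))"
      unfolding \<mu>_def by (subst distr_distr) (auto simp: o_def)
    \<comment> \<open>Equality holds only almost everywhere, since \<open>R\<close> need not fix the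
      default value \<open>c\<close>.\<close>
    also have "\<dots> = distr std_gauss borel (\<lambda>A. Y (\<rho> A))"
    proof (rule distr_cong_AE)
      show "AE A in std_gauss. R (Y A) = Y (\<rho> A)"
        using nonzero
      proof eventually_elim
        case (elim A)
        have "R (row_perp is i A) \<noteq> 0"
          using elim orthogonal_transformation_norm[OF R, of "row_perp is i A"] by auto
        then show ?case
          using elim by (simp add: Y_def scaled_inverse_def perp linear_scale[OF \<open>linear R\<close>] \<open>\<And>x y. R x \<bullet> R y = x \<bullet> y\<close>)
      qed
    qed auto
    also have "\<dots> = distr (distr std_gauss borel \<rho>) borel Y"
      by (subst distr_distr) (auto simp: o_def)
    also have "\<dots> = \<mu>" by (simp add: distr_std_gauss_orthogonal_transformation[OF \<rho>] \<mu>_def)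
    finally show ?thesis .
  qed
  have inv_\<nu>: "distr \<nu> borel R = \<nu>" if R: "orthogonal_transformation R" for R
  proof -
    have [measurable]: "R \<in> borel_measurable borel"
      by (rule orthogonal_transformation_borel_measurable[OF R])
    have RR: "R x \<bullet> R y = x \<bullet> y" for x y using R by (auto simp: orthogonal_transformation_def)
    have "\<nu> = density (distr lborel borel R) (\<lambda>y :: real ^ 'd. ennreal (min_norm_density n xt y))"
      by (simp add: \<nu>_def distr_lborel_orthogonal_transformation[OF R])
    also have "\<dots> = distr \<nu> borel R"
      by (subst density_distr) (simp_all add: \<nu>_def min_norm_density_def RR)
    finally show ?thesis ..
  qed
  have "\<mu> = \<nu>"
    by (rule rotation_invariant_measure_eqI[OF \<mu>.finite_measure_axioms fin _ _ inv_\<mu> inv_\<nu> norm_eq]) simp_all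
  then show ?thesis by (simp add: \<mu>_def \<nu>_def Y_def[abs_def] r_def n_def)
qed

text \<open>Independence makes the joint law of the entries a product over index pairs. Relabelling
  the pairs by the standard basis matrices yields the coordinate description of
  \<open>std_gauss\<close>.\<close>

lemma distr_gaussian_matrix:
  fixes A :: "'a \<Rightarrow> real ^ 'd ^ 'D"
  assumes "prob_space M" and A: "gaussian_matrix M A"
  shows "A \<in> borel_measurable M" "distr M borel A = std_gauss"
proof -
  interpret prob_space M by fact
  define X where "X = (\<lambda>(i, j) \<omega>. A \<omega> $ i $ j)"
  have X: "distributed M lborel (X p) std_normal_density" for p
    using A unfolding gaussian_matrix_def X_def by (cases p) auto
  have [measurable]: "X p \<in> borel_measurable M" for p
    using distributed_measurable[OF X] by simp
  have distr_X: "distr M borel (X p) = std_normal" for p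
    using distributed_distr_eq_density[OF X] by (metis distr_cong sets_lborel)
  have joint: "distr M (PiM UNIV (\<lambda>_. borel)) (\<lambda>\<omega>. \<lambda>p\<in>UNIV. X p \<omega>) = PiM UNIV (\<lambda>_. std_normal)"
    using A indep_vars_iff_distr_eq_PiM[where I = UNIV and M' = "\<lambda>_. borel" and X = X]
    by (simp add: gaussian_matrix_def X_def[symmetric] distr_X)
  define \<beta> where "\<beta> = (\<lambda>(i, j). axis i (axis j 1) :: real ^ 'd ^ 'D)"
  have inj: "inj \<beta>" by (auto simp: \<beta>_def inj_on_def axis_eq_axis)
  have range: "range \<beta> = Basis" by (auto simp: \<beta>_def Basis_vec_def image_iff)
  define \<gamma> where "\<gamma> = inv \<beta>"
  have \<gamma>: "\<gamma> (\<beta> p) = p" for p by (simp add: \<gamma>_def inj)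
  have inj_\<gamma>: "inj_on \<gamma> Basis" unfolding \<gamma>_def range[symmetric] by (rule inj_on_inv_into) simp
  have sum: "(\<Sum>b\<in>Basis. f (\<gamma> b) *\<^sub>R b) = (\<chi> i j. f (i, j))" for f
  proof -
    have "(\<Sum>b\<in>Basis. f (\<gamma> b) *\<^sub>R b) = (\<Sum>p\<in>UNIV. f p *\<^sub>R \<beta> p)"
      unfolding range[symmetric] by (simp add: sum.reindex[OF inj] \<gamma>)
    also have "\<dots> = (\<chi> i j. f (i, j))"
    proof (intro vec_eq_iff[THEN iffD2] allI)
      fix i j
      have entry: "\<beta> p $ i $ j = (if p = (i, j) then 1 else 0)" for p
        by (cases p) (auto simp: \<beta>_def axis_def)
      have "(\<Sum>p\<in>UNIV. f p *\<^sub>R \<beta> p) $ i $ j = (\<Sum>p\<in>UNIV. if p = (i, j) then f p else 0)"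
        by (simp add: entry if_distrib cong: if_cong)
      also have "\<dots> = f (i, j)" by simp
      finally show "(\<Sum>p\<in>UNIV. f p *\<^sub>R \<beta> p) $ i $ j = (\<chi> i j. f (i, j)) $ i $ j" by simp
    qed
    finally show ?thesis .
  qed
  have A_eq: "A \<omega> = (\<Sum>b\<in>Basis. X (\<gamma> b) \<omega> *\<^sub>R b)" for \<omega>
    unfolding sum[of "\<lambda>p. X p \<omega>"] by (simp add: X_def vec_eq_iff)
  have "(\<lambda>\<omega>. \<Sum>b\<in>Basis. X (\<gamma> b) \<omega> *\<^sub>R b) \<in> borel_measurable M" by measurable
  then show "A \<in> borel_measurable M" by (simp only: A_eq[symmetric])
  have "PiM Basis (\<lambda>_. std_normal) = distr (PiM UNIV (\<lambda>_. std_normal)) (PiM Basis (\<lambda>_. std_normal)) (\<lambda>\<omega>. \<lambda>b\<in>Basis. \<omega> (\<gamma> b))"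
    by (rule distr_PiM_reindex[symmetric]) (auto intro: prob_space_std_normal inj_\<gamma>)
  also have "\<dots> = distr (distr M (PiM UNIV (\<lambda>_. borel)) (\<lambda>\<omega>. \<lambda>p\<in>UNIV. X p \<omega>)) (PiM Basis (\<lambda>_. borel)) (\<lambda>\<omega>. \<lambda>b\<in>Basis. \<omega> (\<gamma> b))"
    unfolding joint by (intro distr_cong sets_PiM_cong) auto
  also have "\<dots> = distr M (PiM Basis (\<lambda>_. borel)) (\<lambda>\<omega>. \<lambda>b\<in>Basis. X (\<gamma> b) \<omega>)"
    by (subst distr_distr; (measurable; fail)?) (simp add: o_def)
  finally have PiM_eq: "PiM Basis (\<lambda>_. std_normal) = distr M (PiM Basis (\<lambda>_. borel)) (\<lambda>\<omega>. \<lambda>b\<in>Basis. X (\<gamma> b) \<omega>)" .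
  have "std_gauss = distr (distr M (PiM Basis (\<lambda>_. borel)) (\<lambda>\<omega>. \<lambda>b\<in>Basis. X (\<gamma> b) \<omega>)) borel (\<lambda>f. \<Sum>b\<in>Basis. f b *\<^sub>R b :: real ^ 'd ^ 'D)"
    by (subst std_gauss_eq_distr_PiM, subst PiM_eq) (rule refl)
  also have "\<dots> = distr M borel A"
    by (subst distr_distr; (measurable; fail)?) (simp add: o_def A_eq[symmetric])
  finally show "distr M borel A = std_gauss" ..
qed

text \<open>Adjoin \<open>u\<close> to an orthonormal basis of the part of \<open>T\<close>
  orthogonal to \<open>u\<close>.\<close>

lemma orthonormal_basis_containing:
  fixes T :: "'a::euclidean_space set"
  assumes T: "subspace T" and u: "u \<in> T" "norm u = 1"
  obtains B where "u \<in> B" "pairwise orthogonal B" "\<And>x. x \<in> B \<Longrightarrow> norm x = 1" "card B = dim T" "span B = T"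
proof -
  define W where "W = T \<inter> {x. u \<bullet> x = 0}"
  have "subspace W" unfolding W_def by (intro subspace_inter T subspace_hyperplane)
  then obtain B where B: "B \<subseteq> W" "pairwise orthogonal B" "\<And>x. x \<in> B \<Longrightarrow> norm x = 1" "span B = W"
    using orthonormal_basis_subspace[of W] by metis
  define C where "C = insert u B"
  have orth: "pairwise orthogonal C"
    using B(1,2) by (auto simp: C_def pairwise_insert orthogonal_def W_def inner_commute)
  have nrm: "norm x = 1" if "x \<in> C" for x using that B(3) u by (auto simp: C_def)
  have "C \<subseteq> T" using B(1) u by (auto simp: C_def W_def)
  have span: "span C = T"
  proof
    show "span C \<subseteq> T" using \<open>C \<subseteq> T\<close> T by (rule span_minimal)
    show "T \<subseteq> span C"
    proof
      fix x assume "x \<in> T"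
      then have "x - (u \<bullet> x) *\<^sub>R u \<in> W"
        using u T by (auto simp: W_def inner_diff_right norm_eq_1 intro: subspace_diff subspace_scale)
      then have "x - (u \<bullet> x) *\<^sub>R u \<in> span C"
        using B(4) span_mono[of B C] by (auto simp: C_def)
      then have "(x - (u \<bullet> x) *\<^sub>R u) + (u \<bullet> x) *\<^sub>R u \<in> span C"
        by (rule span_add) (auto simp: C_def intro: span_scale span_base)
      then show "x \<in> span C" by simp
    qed
  qed
  have "independent C"
    using orth nrm[of 0] by (intro pairwise_orthogonal_independent) auto
  then have "card C = dim T" using indep_card_eq_dim_span[of C] span by simp
  show thesis
  proof (rule that)
    show "u \<in> C" by (simp add: C_def)
    show "norm x = 1" if "x \<in> C" for x by (rule nrm[OF that])
  qed fact+
qed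

text \<open>Membership means that \<open>A *v y - x\<close> is orthogonal to \<open>T\<close>, which
  needs testing only on the spanning set \<open>B\<close>; the matrix then moves across the inner
  product.\<close>

lemma solution_set_affine:
  assumes T: "span B = T"
  shows "solution_set A {x + v | v. v \<in> T\<^sup>\<bottom>} = {y. \<forall>b\<in>B. (transpose A *v b) \<bullet> y = b \<bullet> x}"
proof -
  have "A *v y \<in> {x + v | v. v \<in> T\<^sup>\<bottom>} \<longleftrightarrow> (\<forall>b\<in>B. (transpose A *v b) \<bullet> y = b \<bullet> x)" for y
  proof -
    have "A *v y \<in> {x + v | v. v \<in> T\<^sup>\<bottom>} \<longleftrightarrow> A *v y - x \<in> T\<^sup>\<bottom>"
      by (auto intro: exI[of _ "A *v y - x"])
    also have "\<dots> \<longleftrightarrow> (\<forall>b\<in>B. b \<bullet> (A *v y - x) = 0)"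
    proof
      assume *: "\<forall>b\<in>B. b \<bullet> (A *v y - x) = 0"
      have "t \<bullet> (A *v y - x) = 0" if "t \<in> span B" for t
        using that by (induction rule: span_induct_alt) (use * in \<open>auto simp: inner_add_left\<close>)
      then show "A *v y - x \<in> T\<^sup>\<bottom>" using T by (auto simp: orthogonal_comp_def orthogonal_def)
    qed (use T span_base in \<open>auto simp: orthogonal_comp_def orthogonal_def\<close>)
    also have "\<dots> \<longleftrightarrow> (\<forall>b\<in>B. (transpose A *v b) \<bullet> y = b \<bullet> x)"
      by (simp add: inner_diff_right dot_lmul_matrix)
    finally show ?thesis .
  qed
  then show ?thesis by (simp add: solution_set_def)
qed

theorem theorem3p10:
  fixes M :: "'a measure"
    and f :: "real ^ 'D \<Rightarrow> real" and fstar :: real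
    and T :: "(real ^ 'D) set" and U :: "real ^ 'e ^ 'D"
    and xstar xtop :: "real ^ 'D" and Gstar :: "(real ^ 'D) set"
    and A :: "'a \<Rightarrow> real ^ 'd ^ 'D" and n :: nat
  assumes "prob_space M"
    and "continuous_on UNIV f"
    and "is_global_min_value f fstar"
    and "effective_dim f = CARD('e)" and "CARD('e) \<le> CARD('d)"
    and "effective_subspace f T"
    and "orthonormal_columns U" and "span (columns U) = T"
    and "xstar \<in> {x. f x = fstar}"
    and "xtop = (U ** transpose U) *v xstar" and "xtop \<noteq> 0"
    and "Gstar = {xtop + v | v. v \<in> T\<^sup>\<bottom>}"
    and "gaussian_matrix M A"
    and "n = CARD('d) - CARD('e) + 1"
  shows "distributed M lborel (\<lambda>\<omega>. min_norm_element (solution_set (A \<omega>) Gstar))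
           (min_norm_density n xtop :: real ^ 'd \<Rightarrow> real)"
proof -
  interpret prob_space M by fact
  define r u where "r = norm xtop" and "u = xtop /\<^sub>R norm xtop"
  have r: "r > 0" using assms(11) by (simp add: r_def)
  have u: "norm u = 1" "xtop = r *\<^sub>R u" using assms(11) by (auto simp: u_def r_def)
  have T: "subspace T" using assms(8) subspace_span by blast
  have dimT: "dim T = CARD('e)" using assms(4,6) by (simp add: effective_subspace_def)
  have "xtop = U *v (transpose U *v xstar)" unfolding assms(10) by (simp only: matrix_vector_mul_assoc)
  then have "xtop \<in> T"
    using matrix_vector_mult_in_columnspace[of U "transpose U *v xstar"] assms(8) by simp
  then have "u \<in> T" using T by (simp add: u_def subspace_scale)
  then obtain B where B: "u \<in> B" "pairwise orthogonal B" "\<And>x. x \<in> B \<Longrightarrow> norm x = 1" "card B = dim T" "span B = T"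
    using orthonormal_basis_containing[OF T _ u(1)] by metis
  obtain \<tau> J where \<tau>: "orthonormal_family \<tau>" and J: "J \<subseteq> Basis" "bij_betw \<tau> J B"
    using orthonormal_family_exists[OF B(2,3)] by metis
  \<comment> \<open>The indices of those rows of \<open>L A\<close>, defined below, that are images
    of vectors of \<open>B\<close> under the transpose of \<open>A\<close>; \<tau> completes
    \<open>B\<close> to a basis of the whole space.\<close>
  define I where "I = {i :: 'D. axis i 1 \<in> J}"
  have J_eq: "J = (\<lambda>i. axis i 1) ` I" using J(1) by (auto simp: I_def Basis_vec_def)
  have inj_axis: "inj (\<lambda>i::'D. axis i (1::real))" by (auto simp: inj_on_def axis_eq_axis)
  define \<sigma> where "\<sigma> i = \<tau> (axis i 1)" for i :: 'D
  have \<sigma>: "bij_betw \<sigma> I B"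
    using bij_betw_trans[OF inj_on_imp_bij_betw[OF inj_on_subset[OF inj_axis subset_UNIV]] J(2)[unfolded J_eq]]
    by (simp add: \<sigma>_def[abs_def] o_def)
  obtain i0 where i0: "i0 \<in> I" "\<sigma> i0 = u" using \<sigma> B(1) by (auto simp: bij_betw_def)
  obtain "is" where is_set: "set is = I - {i0}" and "distinct is"
    using finite_distinct_list[of "I - {i0}"] by auto
  have len: "length is = CARD('e) - 1"
    using distinct_card[OF \<open>distinct is\<close>] is_set i0 bij_betw_same_card[OF \<sigma>] B(4) dimT by simp
  \<comment> \<open>A type is inhabited, so \<open>CARD('e)\<close> is positive and removing the row
    of \<open>u\<close> leaves fewer than \<open>CARD('d)\<close> rows. For the same reason
    \<open>n\<close> is \<open>CARD('d) - length is\<close>.\<close>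
  have len_less: "length is < CARD('d)"
    using len assms(5) zero_less_card_finite[where 'a = 'e] by linarith
  have n: "n = CARD('d) - length is" using assms(5,14) len zero_less_card_finite[where 'a = 'e] by linarith
  define L where "L A = (\<chi> i. transpose A *v \<tau> (axis i 1))" for A :: "real ^ 'd ^ 'D"
  have L: "orthogonal_transformation L" unfolding L_def by (rule orthogonal_transformation_rows[OF \<tau>])
  have [measurable]: "L \<in> borel_measurable borel" by (rule orthogonal_transformation_borel_measurable[OF L])
  note A [measurable] = distr_gaussian_matrix(1)[OF assms(1,13)]
  define Y where "Y A = scaled_inverse r (min_norm_element {}) (row_perp is i0 A)" for A :: "real ^ 'd ^ 'D"
  have [measurable]: "Y \<in> borel_measurable borel"
    unfolding Y_def scaled_inverse_def by measurable
  have sol: "min_norm_element (solution_set A Gstar) = Y (L A)" for A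
  proof -
    \<comment> \<open>\<open>xtop\<close> is \<open>r\<close> times the basis vector
      \<open>u\<close>, so all but one of the right-hand sides of the linear system vanish.\<close>
    have inner_u: "b \<bullet> xtop = (if b = u then r else 0)" if "b \<in> B" for b
      using B(1,2) that u by (auto simp: pairwise_def orthogonal_def norm_eq_1)
    have "solution_set A Gstar = {y. \<forall>b\<in>B. (transpose A *v b) \<bullet> y = b \<bullet> xtop}"
      unfolding assms(12) by (rule solution_set_affine[OF B(5)])
    also have "\<dots> = {y. \<forall>i\<in>I. L A $ i \<bullet> y = \<sigma> i \<bullet> xtop}"
      unfolding bij_betw_imp_surj_on[OF \<sigma>, symmetric] L_def \<sigma>_def vec_lambda_beta by blast
    also have "\<dots> = {y. \<forall>i\<in>I. L A $ i \<bullet> y = (if i = i0 then r else 0)}"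
    proof (intro Collect_cong ball_cong refl)
      fix y i assume "i \<in> I"
      then have "\<sigma> i \<in> B" "\<sigma> i = u \<longleftrightarrow> i = i0"
        using \<sigma> i0 by (auto simp: bij_betw_def inj_on_def)
      then show "L A $ i \<bullet> y = \<sigma> i \<bullet> xtop \<longleftrightarrow> L A $ i \<bullet> y = (if i = i0 then r else 0)"
        by (simp only: inner_u)
    qed
    also have "\<dots> = {y. L A $ i0 \<bullet> y = r \<and> (\<forall>v\<in>set (map (\<lambda>k. L A $ k) is). v \<bullet> y = 0)}"
      using i0 is_set by auto
    finally show ?thesis
      using min_norm_element_affine[of r "L A $ i0" "map (\<lambda>k. L A $ k) is"] r by (simp add: Y_def row_perp_def)
  qed
  have "distr M lborel (\<lambda>\<omega>. Y (L (A \<omega>))) = distr M borel (\<lambda>\<omega>. Y (L (A \<omega>)))"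
    by (intro distr_cong) auto
  \<comment> \<open>Since \<open>L\<close> preserves \<open>std_gauss\<close>, the rotated matrix
    \<open>L A\<close> may be replaced by a Gaussian matrix in the standard basis.\<close>
  also have "\<dots> = distr (distr (distr M borel A) borel L) borel Y"
    by (simp add: distr_distr o_def)
  also have "\<dots> = distr std_gauss borel Y"
    by (simp add: distr_gaussian_matrix(2)[OF assms(1,13)] distr_std_gauss_orthogonal_transformation[OF L])
  also have "\<dots> = density lborel (min_norm_density n xtop)"
    unfolding Y_def r_def n using is_set \<open>distinct is\<close> len_less assms(11)
    by (intro distr_scaled_inverse_row_perp) auto
  finally show ?thesis
    unfolding distributed_def sol by auto
qed

end
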